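(* Let $K$ be an infinite scattered compact Hausdorff space with $ht(K)<\omega_1$. Then $\mathcal{C}(K)$ has weak*-sequential dual ball, with sequential order $\le ht(K)$ if $ht(K)<\omega$, and with sequential order $\le ht(K)+1$ if $ht(K)\ge\omega$.
   Context: $\mathcal{C}(K)$ is the Banach space of continuous functions on $K$ with the supremum norm. For a scattered compact space $K$, $K^{(\gamma)}$ denotes the $\gamma$th Cantor-Bendixson derivative of $K$, and the height $ht(K)$ is the minimal ordinal $\gamma$ such that $K^{(\gamma)}$ is discrete. For a subset $F$ of a Hausdorff topological space $T$, the sequential closure of $F$ is the set of all limits (in $T$) of convergent sequences of elements of $F$; $F$ is sequentially closed if it equals its sequential closure; $T$ is sequential if every sequentially closed subset is closed. Define $S_0(F)=F$, $S_{\alpha+1}(F)$ the sequential closure of $S_\alpha(F)$, and $S_\alpha(F)=\bigcup_{\beta<\alpha}S_\beta(F)$ for limit $\alpha$. $T$ has sequential order $\alpha$ if $S_\alpha(F)=\overline F$ for every $F\subset T$ and for every $\beta<\alpha$ there is $F\subset T$ with $S_\beta(F)\ne\overline F$. Thus $T$ is sequential with sequential order $\le\alpha$ (where $\alpha\le\omega_1$) iff $S_\alpha(F)=\overline F$ for every $F\subset T$. A Banach space $X$ has weak*-sequential dual ball with sequential order $\le\alpha$ if the closed unit ball $B_{X^*}$ of $X^*$ with the weak* topology is sequential with sequential order $\le\alpha$. *)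

theory Defs
  imports "HOL-Analysis.Analysis"
begin

section \<open>The countable ordinals\<close>

text \<open>The type below carries a well-order of order type $\omega_1$; its elements represent exactly
  the ordinals $< \omega_1$. This is pinned down by \<open>countable_lessThan_cord\<close> (proper initial segments are
  countable) and \<open>countable_bounded_cord\<close> (countable sets are bounded).\<close>

typedef cord = "Field (cardSuc natLeq)"
proof -
  have "infinite (Field (cardSuc natLeq))"
    using Cinfinite_cardSuc[OF natLeq_Cinfinite] by (simp add: cinfinite_def)
  then show ?thesis using infinite_imp_nonempty by blast
qed

lemma wo_cardSuc_natLeq: "Well_order (cardSuc natLeq)"
  using cardSuc_Card_order[OF natLeq_Card_order] by (simp add: card_order_on_well_order_on)

instantiation cord :: wellorder
begin

definition less_eq_cord :: "cord \<Rightarrow> cord \<Rightarrow> bool"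
  where "\<alpha> \<le> \<beta> \<longleftrightarrow> (Rep_cord \<alpha>, Rep_cord \<beta>) \<in> cardSuc natLeq"

definition less_cord :: "cord \<Rightarrow> cord \<Rightarrow> bool"
  where "\<alpha> < \<beta> \<longleftrightarrow> \<alpha> \<le> \<beta> \<and> \<not> \<beta> \<le> (\<alpha> :: cord)"

instance
proof
  have lin: "Linear_order (cardSuc natLeq)" and wf: "wf (cardSuc natLeq - Id)"
    using wo_cardSuc_natLeq by (auto simp: well_order_on_def)
  have refl: "Refl (cardSuc natLeq)" and tr: "trans (cardSuc natLeq)"
    and anti: "antisym (cardSuc natLeq)" and tot: "Total (cardSuc natLeq)"
    using lin by (auto simp: linear_order_on_def partial_order_on_def preorder_on_def)
  fix \<alpha> \<beta> \<gamma> :: cord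
  show "\<alpha> < \<beta> \<longleftrightarrow> \<alpha> \<le> \<beta> \<and> \<not> \<beta> \<le> \<alpha>" by (rule less_cord_def)
  show r: "\<alpha> \<le> \<alpha>" for \<alpha> :: cord
    using refl Rep_cord by (auto simp: less_eq_cord_def refl_on_def)
  show "\<alpha> \<le> \<gamma>" if "\<alpha> \<le> \<beta>" "\<beta> \<le> \<gamma>"
    using that tr by (auto simp: less_eq_cord_def dest: transD)
  show anti': "\<alpha> = \<beta>" if "\<alpha> \<le> \<beta>" "\<beta> \<le> \<alpha>" for \<alpha> \<beta> :: cord
    using that anti by (auto simp: less_eq_cord_def Rep_cord_inject dest: antisymD)
  show "\<alpha> \<le> \<beta> \<or> \<beta> \<le> \<alpha>"
    using tot Rep_cord r by (cases "\<alpha> = \<beta>") (auto simp: less_eq_cord_def total_on_def Rep_cord_inject)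
  show "P \<alpha>" if step: "\<And>\<alpha>. (\<And>\<beta>. \<beta> < \<alpha> \<Longrightarrow> P \<beta>) \<Longrightarrow> P \<alpha>" for P and \<alpha> :: cord
  proof -
    have "wf (inv_image (cardSuc natLeq - Id) Rep_cord)" using wf by simp
    then show ?thesis
    proof (induction \<alpha> rule: wf_induct_rule)
      case (less \<alpha>)
      show ?case
      proof (rule step)
        fix \<beta> assume "\<beta> < \<alpha>"
        then show "P \<beta>"
          using r by (intro less.IH) (auto simp: less_cord_def less_eq_cord_def Rep_cord_inject)
      qed
    qed
  qed
qed

end

lemma countable_iff_ordLeq_natLeq: "countable A \<longleftrightarrow> (card_of A, natLeq) \<in> ordLeq"
proof -
  have "countable A \<longleftrightarrow> (card_of A, card_of (UNIV :: nat set)) \<in> ordLeq"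
    using card_of_ordLeq[of A "UNIV :: nat set"] by (simp only: countable_def subset_UNIV simp_thms)
  then show ?thesis
    by (meson card_of_nat ordIso_symmetric ordLeq_ordIso_trans)
qed

lemma countable_lessThan_cord: "countable {..<\<alpha> :: cord}"
proof -
  include cardinal_syntax
  let ?r = "cardSuc natLeq" and ?U = "underS (cardSuc natLeq) (Rep_cord \<alpha>)"
  have "|?U| <o ?r"
    using card_of_underS[OF cardSuc_Card_order[OF natLeq_Card_order]] Rep_cord by blast
  then have "|?U| \<le>o natLeq"
    using cardSuc_ordLeq_ordLess[OF natLeq_Card_order] card_of_Card_order by blast
  then have "countable ?U"
    by (simp add: countable_iff_ordLeq_natLeq)
  moreover have "Rep_cord ` {..<\<alpha>} \<subseteq> ?U"
    by (auto simp: underS_def less_cord_def less_eq_cord_def)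
  ultimately have "countable (Rep_cord ` {..<\<alpha>})" using countable_subset by blast
  then show ?thesis
    by (rule countable_image_inj_on) (auto simp: inj_on_def Rep_cord_inject)
qed

lemma uncountable_cord: "uncountable (UNIV :: cord set)"
proof
  include cardinal_syntax
  assume "countable (UNIV :: cord set)"
  then have "countable (range Rep_cord)" by blast
  then have "countable (Field (cardSuc natLeq))"
    using type_definition.Rep_range[OF type_definition_cord] by simp
  then have "|Field (cardSuc natLeq)| \<le>o natLeq"
    by (simp add: countable_iff_ordLeq_natLeq)
  then have "cardSuc natLeq \<le>o natLeq"
    using card_of_Field_ordIso[OF cardSuc_Card_order[OF natLeq_Card_order]]
      ordIso_ordLeq_trans ordIso_symmetric by blast
  then show False
    using cardSuc_greater[OF natLeq_Card_order] not_ordLess_ordLeq by blast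
qed

lemma countable_bounded_cord:
  assumes "countable A"
  shows "\<exists>\<beta> :: cord. \<forall>\<alpha>\<in>A. \<alpha> < \<beta>"
proof (rule ccontr)
  assume unbounded: "\<not> ?thesis"
  have "\<beta> \<in> (\<Union>\<alpha>\<in>A. insert \<alpha> {..<\<alpha>})" for \<beta>
  proof -
    obtain \<alpha> where "\<alpha> \<in> A" "\<not> \<alpha> < \<beta>" using unbounded by blast
    then have "\<alpha> \<in> A" "\<beta> = \<alpha> \<or> \<beta> < \<alpha>" by (auto simp: not_less le_less)
    then show ?thesis by blast
  qed
  then have "UNIV = (\<Union>\<alpha>\<in>A. insert \<alpha> {..<\<alpha>})" by blast
  moreover have "countable (\<Union>\<alpha>\<in>A. insert \<alpha> {..<\<alpha>})"
    using assms countable_lessThan_cord by auto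
  ultimately show False using uncountable_cord by simp
qed

instantiation cord :: zero
begin
definition zero_cord :: cord where "0 = (LEAST \<alpha> :: cord. True)"
instance ..
end

definition osuc :: "cord \<Rightarrow> cord"
  where "osuc \<alpha> = (LEAST \<beta>. \<alpha> < \<beta>)"

definition olimit :: "cord \<Rightarrow> bool"
  where "olimit \<alpha> \<longleftrightarrow> \<alpha> \<noteq> 0 \<and> (\<forall>\<beta><\<alpha>. osuc \<beta> < \<alpha>)"

definition oomega :: cord
  where "oomega = (LEAST \<alpha>. olimit \<alpha>)"

lemma zero_le_cord [simp]: "0 \<le> (\<alpha> :: cord)"
  by (simp add: zero_cord_def Least_le)

lemma less_osuc [simp]: "\<alpha> < osuc \<alpha>"
  unfolding osuc_def using countable_bounded_cord[of "{\<alpha>}"] by (auto intro: LeastI)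

lemma osuc_le_iff: "osuc \<alpha> \<le> \<beta> \<longleftrightarrow> \<alpha> < \<beta>"
  by (metis Least_le less_osuc order_less_le_trans osuc_def)

lemma osuc_inject [simp]: "osuc \<alpha> = osuc \<beta> \<longleftrightarrow> \<alpha> = \<beta>"
  by (metis less_osuc linorder_neqE not_less osuc_le_iff)

lemma osuc_neq_0 [simp]: "osuc \<alpha> \<noteq> 0" "0 \<noteq> osuc \<alpha>"
  by (metis less_osuc not_less zero_le_cord)+

lemma not_olimit_0 [simp]: "\<not> olimit 0"
  by (simp add: olimit_def)

lemma not_olimit_osuc [simp]: "\<not> olimit (osuc \<alpha>)"
  using less_osuc[of \<alpha>] by (auto simp: olimit_def intro!: exI[of _ \<alpha>])

lemma cord_exhaust:
  obtains "\<alpha> = 0" | \<beta> where "\<alpha> = osuc \<beta>" | "olimit \<alpha>"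
  by (metis antisym_conv2 less_osuc not_less olimit_def osuc_le_iff)

lemma olimit_oomega: "olimit oomega"
proof -
  define A where "A = range (\<lambda>n. (osuc ^^ n) 0)"
  define \<gamma> where "\<gamma> = (LEAST \<beta>. \<forall>\<alpha>\<in>A. \<alpha> < \<beta>)"
  have "\<exists>\<beta>. \<forall>\<alpha>\<in>A. \<alpha> < \<beta>"
    by (rule countable_bounded_cord) (simp add: A_def)
  then have above: "\<forall>\<alpha>\<in>A. \<alpha> < \<gamma>"
    unfolding \<gamma>_def by (rule LeastI_ex)
  have "0 \<in> A" unfolding A_def by (rule range_eqI[of _ _ 0]) simp
  have suc: "osuc \<alpha> \<in> A" if a: "\<alpha> \<in> A" for \<alpha>
  proof -
    obtain n where "\<alpha> = (osuc ^^ n) 0" using a unfolding A_def by blast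
    then have "osuc \<alpha> = (osuc ^^ Suc n) 0" by simp
    then show ?thesis unfolding A_def by blast
  qed
  have "osuc \<beta> < \<gamma>" if b: "\<beta> < \<gamma>" for \<beta>
  proof -
    obtain \<alpha> where "\<alpha> \<in> A" "\<beta> \<le> \<alpha>"
      using not_less_Least[OF b[unfolded \<gamma>_def]] by (auto simp: not_less)
    have "osuc \<beta> \<le> osuc \<alpha>"
      unfolding osuc_le_iff using \<open>\<beta> \<le> \<alpha>\<close> less_osuc by (rule order_le_less_trans)
    moreover have "osuc \<alpha> < \<gamma>"
      using above suc \<open>\<alpha> \<in> A\<close> by blast
    ultimately show ?thesis by (rule order_le_less_trans)
  qed
  moreover have "\<gamma> \<noteq> 0"
    using above \<open>0 \<in> A\<close> by auto
  ultimately have "olimit \<gamma>" by (simp add: olimit_def)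
  then show ?thesis unfolding oomega_def by (rule LeastI)
qed

lemma less_oomega_iff: "\<alpha> < oomega \<longleftrightarrow> (\<exists>n. \<alpha> = (osuc ^^ n) 0)"
proof
  show "\<exists>n. \<alpha> = (osuc ^^ n) 0" if "\<alpha> < oomega"
    using that
  proof (induction \<alpha> rule: less_induct)
    case (less \<alpha>)
    show ?case
    proof (cases \<alpha> rule: cord_exhaust)
      case 1
      then show ?thesis by (intro exI[of _ 0]) simp
    next
      case (2 \<beta>)
      then have "\<beta> < \<alpha>" by simp
      then obtain n where "\<beta> = (osuc ^^ n) 0"
        using less.IH less.prems order_less_trans by blast
      then show ?thesis using 2 by (intro exI[of _ "Suc n"]) simp
    next
      case 3
      then show ?thesis using less.prems not_less_Least unfolding oomega_def by blast
    qed
  qed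
  have "(osuc ^^ n) 0 < oomega" for n
    using olimit_oomega by (induction n) (auto simp: olimit_def order_less_le)
  then show "\<exists>n. \<alpha> = (osuc ^^ n) 0 \<Longrightarrow> \<alpha> < oomega" by blast
qed

lemma wf_snd_cord: "wf {(x, y). snd x < (snd y :: cord)}"
  using wf_inv_image[OF wf, of snd] by (simp add: inv_image_def)


section \<open>Cantor--Bendixson derivatives\<close>

function cb_derivative :: "'a::topological_space set \<Rightarrow> cord \<Rightarrow> 'a set" where
  "cb_derivative K 0 = K"
| "cb_derivative K (osuc \<alpha>) = {x \<in> cb_derivative K \<alpha>. x islimpt cb_derivative K \<alpha>}"
| "olimit \<alpha> \<Longrightarrow> cb_derivative K \<alpha> = (\<Inter>\<beta>\<in>{..<\<alpha>}. cb_derivative K \<beta>)"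
proof -
  fix P :: bool and x :: "'a set \<times> cord"
  assume "\<And>K. x = (K, 0) \<Longrightarrow> P" "\<And>K \<alpha>. x = (K, osuc \<alpha>) \<Longrightarrow> P"
    "\<And>\<alpha> K. \<lbrakk>olimit \<alpha>; x = (K, \<alpha>)\<rbrakk> \<Longrightarrow> P"
  then show P by (metis cord_exhaust prod.exhaust)
qed auto
termination
  by (relation "{(x, y). snd x < snd y}") (auto simp: wf_snd_cord)

definition scattered :: "'a::topological_space set \<Rightarrow> bool"
  where "scattered K \<longleftrightarrow> (\<forall>A\<subseteq>K. A \<noteq> {} \<longrightarrow> (\<exists>x. x isolated_in A))"

definition ht_less_omega1 :: "'a::topological_space set \<Rightarrow> bool"
  where "ht_less_omega1 K \<longleftrightarrow> (\<exists>\<alpha>. discrete (cb_derivative K \<alpha>))"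

text \<open>Meaningful only under \<^const>\<open>ht_less_omega1\<close>: ordinals from $\omega_1$ on are not
  represented in \<^typ>\<open>cord\<close>.\<close>

definition ht :: "'a::topological_space set \<Rightarrow> cord"
  where "ht K = (LEAST \<alpha>. discrete (cb_derivative K \<alpha>))"


section \<open>Sequential spaces and sequential order\<close>

definition seq_closure :: "'a topology \<Rightarrow> 'a set \<Rightarrow> 'a set"
  where "seq_closure T F = {x. \<exists>s. (\<forall>n. s n \<in> F) \<and> limitin T s x sequentially}"

definition seq_closed :: "'a topology \<Rightarrow> 'a set \<Rightarrow> bool"
  where "seq_closed T F \<longleftrightarrow> F \<subseteq> topspace T \<and> seq_closure T F = F"

definition sequential_space :: "'a topology \<Rightarrow> bool"
  where "sequential_space T \<longleftrightarrow> (\<forall>F. seq_closed T F \<longrightarrow> closedin T F)"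

function seq_closure_iter :: "'a topology \<Rightarrow> 'a set \<Rightarrow> cord \<Rightarrow> 'a set" where
  "seq_closure_iter T F 0 = F"
| "seq_closure_iter T F (osuc \<alpha>) = seq_closure T (seq_closure_iter T F \<alpha>)"
| "olimit \<alpha> \<Longrightarrow> seq_closure_iter T F \<alpha> = (\<Union>\<beta>\<in>{..<\<alpha>}. seq_closure_iter T F \<beta>)"
proof -
  fix P :: bool and x :: "'a topology \<times> 'a set \<times> cord"
  assume "\<And>T F. x = (T, F, 0) \<Longrightarrow> P" "\<And>T F \<alpha>. x = (T, F, osuc \<alpha>) \<Longrightarrow> P"
    "\<And>\<alpha> T F. \<lbrakk>olimit \<alpha>; x = (T, F, \<alpha>)\<rbrakk> \<Longrightarrow> P"
  then show P by (metis cord_exhaust prod.exhaust)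
qed auto
termination
  by (relation "{(x, y). snd (snd x) < snd (snd y)}")
     (use wf_inv_image[OF wf_snd_cord, of snd] in \<open>auto simp: inv_image_def\<close>)

definition has_sequential_order :: "'a topology \<Rightarrow> cord \<Rightarrow> bool"
  where "has_sequential_order T \<alpha> \<longleftrightarrow>
    (\<forall>F\<subseteq>topspace T. seq_closure_iter T F \<alpha> = T closure_of F) \<and>
    (\<forall>\<beta><\<alpha>. \<exists>F\<subseteq>topspace T. seq_closure_iter T F \<beta> \<noteq> T closure_of F)"

definition sequential_order_le :: "'a topology \<Rightarrow> cord \<Rightarrow> bool"
  where "sequential_order_le T \<alpha> \<longleftrightarrow> (\<exists>\<beta>\<le>\<alpha>. has_sequential_order T \<beta>)"


section \<open>The dual ball\<close>

text \<open>The library declares \<^typ>\<open>'k \<Rightarrow>\<^sub>C real\<close> complete only for metric \<^typ>\<open>'k\<close>, and that arity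
  excludes a more general one. The definitions below are therefore stated for normed spaces;
  completeness holds as a theorem.\<close>

lemma complete_bcontfun: "complete (UNIV :: ('k::topological_space \<Rightarrow>\<^sub>C 'b::banach) set)"
  unfolding complete_def
proof safe
  fix f :: "nat \<Rightarrow> 'k \<Rightarrow>\<^sub>C 'b"
  assume "Cauchy f"
  then obtain g where "uniform_limit UNIV f g sequentially"
    using uniformly_convergent_eq_cauchy[of "\<lambda>_. True" f]
    unfolding Cauchy_def uniform_limit_sequentially_iff
    by (metis dist_fun_lt_imp_dist_val_lt)
  from uniform_limit_bcontfunE[OF this sequentially_bot]
  obtain l where "f \<longlonglongrightarrow> l" by metis
  then show "\<exists>l\<in>UNIV. f \<longlonglongrightarrow> l" by (intro bexI[of _ l] UNIV_I)
qed

text \<open>For real-valued functionals the strong operator topology, i.e. the topology of pointwise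
  convergence on \<^typ>\<open>'x \<Rightarrow>\<^sub>L real\<close>, is the weak* topology of the dual.\<close>

definition weak_star_dual_ball :: "'x::real_normed_vector itself \<Rightarrow> ('x \<Rightarrow>\<^sub>L real) topology"
  where "weak_star_dual_ball _ = subtopology strong_operator_topology (cball 0 1)"

definition weak_star_sequential_dual_ball_le :: "'x::real_normed_vector itself \<Rightarrow> cord \<Rightarrow> bool"
  where "weak_star_sequential_dual_ball_le X \<alpha> \<longleftrightarrow>
    sequential_space (weak_star_dual_ball X) \<and> sequential_order_le (weak_star_dual_ball X) \<alpha>"

end

theory Submission
  imports Defs "HOL-Library.Diagonal_Subsequence"
begin

text \<open>
  Let \<open>Y\<^sub>\<beta>\<close> be the functions vanishing on the \<open>\<beta>\<close>-th derivative, and let \<open>x\<close> lie in the weak* closure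
  of a subset \<open>F\<close> of the dual ball. By induction on \<open>\<beta>\<close>, after \<open>\<beta>\<close> sequential closures of \<open>F\<close>
  (\<open>\<beta> + 1\<close> if \<open>\<beta>\<close> is infinite) one reaches, weak*-close to \<open>x\<close>, functionals that agree with \<open>x\<close> on \<open>Y\<^sub>\<beta>\<close>.
  For the successor step, \<open>Y\<^bsub>\<beta>+1\<^esub>\<close> is spanned by \<open>Y\<^sub>\<beta>\<close> and the peak functions of the isolated points of
  the \<open>\<beta>\<close>-th derivative; a functional that agrees with \<open>x\<close> on \<open>Y\<^sub>\<beta>\<close> differs from it on countably many
  peaks only, as on the dual of $c_0$, so a closing-off argument produces a sequence converging to \<open>x\<close>
  on \<open>Y\<^bsub>\<beta>+1\<^esub>\<close>. At limits one uses a cofinal sequence. The last derivative is finite,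
  whence equality with \<open>x\<close>. The passage from convergence on a subspace to convergence rests on the
  weak* sequential compactness of the dual ball, obtained by a similar induction.
\<close>

section \<open>Transfinite iteration\<close>

lemma subset_seq_closure: "F \<subseteq> topspace T \<Longrightarrow> F \<subseteq> seq_closure T F"
proof
  fix x assume "F \<subseteq> topspace T" "x \<in> F"
  then show "x \<in> seq_closure T F"
    unfolding seq_closure_def by (auto intro!: exI[of _ "\<lambda>_. x"])
qed

lemma seq_closure_subset_closure_of: "seq_closure T F \<subseteq> T closure_of F"
proof
  fix x assume "x \<in> seq_closure T F"
  then obtain s where s: "\<forall>n. s n \<in> F" "limitin T s x sequentially"
    unfolding seq_closure_def by blast
  show "x \<in> T closure_of F"
    unfolding in_closure_of
  proof (intro conjI allI impI)
    show "x \<in> topspace T" using s(2) limitin_topspace by fast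
    fix U assume "x \<in> U \<and> openin T U"
    then have "\<forall>\<^sub>F n in sequentially. s n \<in> U"
      using s(2) unfolding limitin_def by blast
    then show "\<exists>y. y \<in> F \<and> y \<in> U"
      using s(1) eventually_happens[of _ sequentially] by fastforce
  qed
qed

lemma less_osuc_iff: "\<alpha> < osuc \<beta> \<longleftrightarrow> \<alpha> \<le> \<beta>"
  using osuc_le_iff[of \<beta> \<alpha>] by (metis not_less osuc_le_iff)

lemma olimit_pos: "olimit \<alpha> \<Longrightarrow> 0 < \<alpha>"
  using order_le_neq_trans[OF zero_le_cord, of \<alpha>] not_olimit_0 by blast

lemma olimit_osuc_less: "olimit \<alpha> \<Longrightarrow> \<beta> < \<alpha> \<Longrightarrow> osuc \<beta> < \<alpha>"
  unfolding olimit_def by blast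

text \<open>Both inclusions go through one induction: the upper one keeps the iterates inside the
  space, as \<open>subset_seq_closure\<close> requires at successors.\<close>

lemma seq_closure_iter_bounds:
  assumes "F \<subseteq> topspace T"
  shows "F \<subseteq> seq_closure_iter T F \<alpha> \<and> seq_closure_iter T F \<alpha> \<subseteq> T closure_of F"
proof (induction \<alpha> rule: less_induct)
  case (less \<alpha>)
  show ?case
  proof (cases \<alpha> rule: cord_exhaust)
    case 1
    show ?thesis unfolding 1 using closure_of_subset[OF assms] by simp
  next
    case (2 \<beta>)
    have "\<beta> < \<alpha>" unfolding 2 by (rule less_osuc)
    then have IH: "F \<subseteq> seq_closure_iter T F \<beta>" "seq_closure_iter T F \<beta> \<subseteq> T closure_of F"
      using less.IH[OF \<open>\<beta> < \<alpha>\<close>] by simp_all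
    have "seq_closure_iter T F \<beta> \<subseteq> topspace T"
      using IH(2) closure_of_subset_topspace by (rule order_trans)
    then have "F \<subseteq> seq_closure T (seq_closure_iter T F \<beta>)"
      by (intro order_trans[OF IH(1)] subset_seq_closure)
    moreover have "seq_closure T (seq_closure_iter T F \<beta>) \<subseteq> T closure_of F"
      using order_trans[OF seq_closure_subset_closure_of[of T] closure_of_mono[OF IH(2), of T]]
      unfolding closure_of_closure_of .
    ultimately show ?thesis unfolding 2 by simp
  next
    case 3
    have pos: "0 < \<alpha>" using 3 by (rule olimit_pos)
    have "0 \<in> {..<\<alpha>}" using pos by simp
    then have "seq_closure_iter T F 0 \<subseteq> (\<Union>\<beta>\<in>{..<\<alpha>}. seq_closure_iter T F \<beta>)"
      by (rule UN_upper)
    then have "F \<subseteq> (\<Union>\<beta>\<in>{..<\<alpha>}. seq_closure_iter T F \<beta>)" unfolding seq_closure_iter.simps(1) .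
    moreover have "(\<Union>\<beta>\<in>{..<\<alpha>}. seq_closure_iter T F \<beta>) \<subseteq> T closure_of F"
      by (rule UN_least) (rule conjunct2[OF less.IH], simp)
    ultimately show ?thesis by (simp only: seq_closure_iter.simps(3)[OF 3] simp_thms)
  qed
qed

lemma seq_closure_iter_subset_topspace:
  "F \<subseteq> topspace T \<Longrightarrow> seq_closure_iter T F \<alpha> \<subseteq> topspace T"
  using order_trans[OF conjunct2[OF seq_closure_iter_bounds] closure_of_subset_topspace] .

lemma seq_closed_imp_seq_closure_iter_eq:
  assumes "seq_closed T F"
  shows "seq_closure_iter T F \<alpha> = F"
proof (induction \<alpha> rule: less_induct)
  case (less \<alpha>)
  show ?case
  proof (cases \<alpha> rule: cord_exhaust)
    case (2 \<beta>)
    then show ?thesis using less.IH[of \<beta>] assms by (simp add: seq_closed_def)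
  next
    case 3
    then have "{..<\<alpha>} \<noteq> {}" using olimit_pos by blast
    then show ?thesis using 3 less.IH by auto
  qed simp
qed

text \<open>Since \<open>has_sequential_order\<close> asks for the exact order, the bound \<alpha>
  is traded for the least ordinal that works. Sequentiality follows because iteration leaves a
  sequentially closed set unchanged.\<close>

lemma sequential_if_seq_closure_iter_eq_closure:
  assumes "\<And>F. F \<subseteq> topspace T \<Longrightarrow> T closure_of F \<subseteq> seq_closure_iter T F \<alpha>"
  shows "sequential_space T" "sequential_order_le T \<alpha>"
proof -
  have eq: "seq_closure_iter T F \<alpha> = T closure_of F" if "F \<subseteq> topspace T" for F
    using assms[OF that] seq_closure_iter_bounds[OF that, of \<alpha>] by blast
  show "sequential_space T"
    unfolding sequential_space_def
  proof (intro allI impI)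
    fix F assume F: "seq_closed T F"
    then have "T closure_of F = F"
      using eq[of F] seq_closed_imp_seq_closure_iter_eq[OF F, of \<alpha>] by (simp add: seq_closed_def)
    then show "closedin T F" by (metis closedin_closure_of)
  qed
  \<comment> \<open>By minimality each smaller ordinal fails for some F, which is the second clause
    of \<open>has_sequential_order\<close>.\<close>
  define \<beta> where "\<beta> = (LEAST \<beta>. \<forall>F\<subseteq>topspace T. seq_closure_iter T F \<beta> = T closure_of F)"
  have "\<beta> \<le> \<alpha>" unfolding \<beta>_def by (rule Least_le) (use eq in blast)
  moreover have "has_sequential_order T \<beta>"
    unfolding has_sequential_order_def
  proof (intro conjI allI impI)
    have "\<forall>F\<subseteq>topspace T. seq_closure_iter T F \<beta> = T closure_of F"
      unfolding \<beta>_def by (rule LeastI[of _ \<alpha>]) (use eq in blast)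
    then show "seq_closure_iter T F \<beta> = T closure_of F" if "F \<subseteq> topspace T" for F using that by blast
    show "\<exists>F\<subseteq>topspace T. seq_closure_iter T F \<gamma> \<noteq> T closure_of F" if "\<gamma> < \<beta>" for \<gamma>
      using not_less_Least[OF that[unfolded \<beta>_def]] by blast
  qed
  ultimately show "sequential_order_le T \<alpha>"
    unfolding sequential_order_le_def by blast
qed

text \<open>Bound on the number of sequential closures after which the functional agrees with its target
  on the functions vanishing on the \<open>\<beta>\<close>-th derivative; one step is lost at the first limit only.\<close>

definition order_bound :: "cord \<Rightarrow> cord"
  where "order_bound \<beta> = (if \<beta> < oomega then \<beta> else osuc \<beta>)"

lemma order_bound_0: "order_bound 0 = 0"
  unfolding order_bound_def using olimit_pos[OF olimit_oomega] by simp

text \<open>No successor step crosses the limit \<open>oomega\<close>, so both sides use the same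
  branch of the definition.\<close>

lemma order_bound_osuc: "order_bound (osuc \<beta>) = osuc (order_bound \<beta>)"
proof -
  have "osuc \<beta> < oomega \<longleftrightarrow> \<beta> < oomega"
    using olimit_osuc_less[OF olimit_oomega, of \<beta>] order_less_trans[OF less_osuc, of \<beta> oomega] by blast
  then show ?thesis unfolding order_bound_def by simp
qed

text \<open>Every limit ordinal is at least \<open>oomega\<close> and closed under successors. The
  strict inequality puts all earlier stages into the union forming the iterate at \<eta>; the extra
  successor leaves room for the limit of a sequence drawn from that union.\<close>

lemma order_bound_olimit:
  assumes "olimit \<eta>"
  shows "order_bound \<eta> = osuc \<eta>" and "\<beta> < \<eta> \<Longrightarrow> order_bound \<beta> < \<eta>"
proof -
  have "oomega \<le> \<eta>" unfolding oomega_def using assms by (rule Least_le)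
  then show "order_bound \<eta> = osuc \<eta>" unfolding order_bound_def using leD by auto
  show "\<beta> < \<eta> \<Longrightarrow> order_bound \<beta> < \<eta>"
    unfolding order_bound_def using olimit_osuc_less[OF assms] by simp
qed

text \<open>Only countably many ordinals lie below \<eta>; running maxima of an enumeration of them
  are monotone and stay below \<eta>.\<close>

lemma olimit_cofinal_sequence:
  assumes "olimit \<eta>"
  obtains b where "\<And>n::nat. b n < \<eta>" "\<And>\<beta>. \<beta> < \<eta> \<Longrightarrow> \<exists>n. \<beta> \<le> b n" "mono b"
proof -
  have ne: "{..<\<eta>} \<noteq> {}" using assms olimit_pos by blast
  then obtain c :: "nat \<Rightarrow> cord" where c: "range c = {..<\<eta>}"
    using countable_lessThan_cord uncountable_def by metis
  define b where "b n = Max (c ` {..n})" for n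
  have "b n < \<eta>" for n
  proof -
    have "\<forall>x\<in>c ` {..n}. x < \<eta>" using c by blast
    then show ?thesis unfolding b_def by simp
  qed
  moreover have "\<exists>n. \<beta> \<le> b n" if "\<beta> < \<eta>" for \<beta>
  proof -
    have "\<beta> \<in> range c" unfolding c using that by simp
    then obtain n where "\<beta> = c n" by blast
    then have "\<beta> \<le> b n" unfolding b_def by (intro Max_ge) auto
    then show ?thesis by blast
  qed
  moreover have "mono b"
  proof (rule monoI)
    fix m n :: nat assume "m \<le> n"
    then show "b m \<le> b n" unfolding b_def by (intro Max_mono image_mono) simp_all
  qed
  ultimately show ?thesis by (rule that)
qed

section \<open>Monotonicity and closedness of the Cantor-Bendixson derivatives\<close>

lemma cb_derivative_antimono:
  "\<alpha> \<le> \<beta> \<Longrightarrow> cb_derivative K \<beta> \<subseteq> cb_derivative K \<alpha>"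
proof (induction \<beta> rule: less_induct)
  case (less \<beta>)
  show ?case
  proof (cases "\<alpha> = \<beta>")
    case False
    then have "\<alpha> < \<beta>" using less.prems by simp
    show ?thesis
    proof (cases \<beta> rule: cord_exhaust)
      case 1
      then show ?thesis using \<open>\<alpha> < \<beta>\<close> leD[OF zero_le_cord[of \<alpha>]] by blast
    next
      case (2 \<gamma>)
      then have "\<alpha> \<le> \<gamma>" "\<gamma> < \<beta>" using \<open>\<alpha> < \<beta>\<close> by (simp_all add: less_osuc_iff)
      then show ?thesis using less.IH 2 by fastforce
    next
      case 3
      then show ?thesis using \<open>\<alpha> < \<beta>\<close> by auto
    qed
  qed simp
qed

lemma closed_derived_set:
  fixes L :: "'a::t1_space set"
  assumes "closed L"
  shows "closed {x \<in> L. x islimpt L}"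
proof -
  have "y \<in> L \<and> y islimpt L" if "y islimpt {x \<in> L. x islimpt L}" for y
    using that assms closed_limpt islimpt_subset[of y "{x \<in> L. x islimpt L}" L] by blast
  then show ?thesis unfolding closed_limpt by blast
qed

lemma closed_cb_derivative:
  fixes K :: "'a::t1_space set"
  assumes "closed K"
  shows "closed (cb_derivative K \<alpha>)"
proof (induction \<alpha> rule: less_induct)
  case (less \<alpha>)
  show ?case
  proof (cases \<alpha> rule: cord_exhaust)
    case 1
    then show ?thesis using assms by simp
  next
    case (2 \<beta>)
    then show ?thesis using less.IH[of \<beta>] closed_derived_set by simp
  next
    case 3
    then show ?thesis using less.IH by auto
  qed
qed

section \<open>The weak* topology of the dual ball\<close>

lemma topspace_weak_star_dual_ball [simp]:
  "topspace (weak_star_dual_ball TYPE('x::real_normed_vector)) = cball 0 1"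
  by (simp add: weak_star_dual_ball_def strong_operator_topology_topspace)

text \<open>Finite test sets give the basic weak* neighbourhoods, so this is adherence in the whole
  dual, in a form suited to choosing approximants one finite set at a time.\<close>

definition weak_star_adherent ::
    "('x::real_normed_vector \<Rightarrow>\<^sub>L real) \<Rightarrow> ('x \<Rightarrow>\<^sub>L real) set \<Rightarrow> bool"
  where "weak_star_adherent x F \<longleftrightarrow>
    (\<forall>C e. finite C \<longrightarrow> 0 < e \<longrightarrow> (\<exists>y\<in>F. \<forall>c\<in>C. \<bar>blinfun_apply y c - blinfun_apply x c\<bar> < e))"

lemma weak_star_adherent_if_in_closure:
  fixes F :: "('x::real_normed_vector \<Rightarrow>\<^sub>L real) set"
  assumes "x \<in> weak_star_dual_ball TYPE('x) closure_of F"
  shows "weak_star_adherent x F"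
  unfolding weak_star_adherent_def
proof (intro allI impI)
  fix C :: "'x set" and e :: real
  assume "finite C" "0 < e"
  define U where "U = {y. \<forall>c\<in>C. blinfun_apply y c \<in> ball (blinfun_apply x c) e}"
  have "openin strong_operator_topology U"
    unfolding U_def using strong_operator_topology_basis[OF \<open>finite C\<close>, of "\<lambda>c. ball (blinfun_apply x c) e" "\<lambda>c. c"]
    by simp
  then have "openin (weak_star_dual_ball TYPE('x)) (U \<inter> cball 0 1)"
    unfolding weak_star_dual_ball_def openin_subtopology by blast
  moreover have "x \<in> U \<inter> cball 0 1"
    using assms \<open>0 < e\<close> closure_of_subset_topspace[of "weak_star_dual_ball TYPE('x)" F]
    by (auto simp: U_def)
  ultimately obtain y where "y \<in> F" "y \<in> U" using assms unfolding in_closure_of by blast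
  then show "\<exists>y\<in>F. \<forall>c\<in>C. \<bar>blinfun_apply y c - blinfun_apply x c\<bar> < e"
    by (intro bexI[of _ y]) (auto simp: U_def dist_real_def abs_minus_commute)
qed

section \<open>Pointwise limits of bounded families of functionals\<close>

lemma norm_le_if_pointwise_limit:
  fixes s :: "nat \<Rightarrow> 'x::real_normed_vector \<Rightarrow>\<^sub>L real"
  assumes "\<And>n. norm (s n) \<le> M" and lim: "\<And>f. (\<lambda>n. blinfun_apply (s n) f) \<longlonglongrightarrow> blinfun_apply l f"
  shows "norm l \<le> M"
proof (rule norm_blinfun_bound)
  show "0 \<le> M" using assms(1)[of 0] norm_ge_zero order_trans by blast
  fix f
  have "norm (blinfun_apply (s n) f) \<le> M * norm f" for n
    using norm_blinfun[of "s n" f] mult_right_mono[OF assms(1)[of n], of "norm f"] by simp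
  then show "norm (blinfun_apply l f) \<le> M * norm f"
    using tendsto_norm[OF lim[of f]] by (intro LIMSEQ_le_const2) auto
qed

text \<open>The strong operator topology is pulled back from the product topology along
  \<open>blinfun_apply\<close>, so pointwise convergence is convergence in it; the norm bound keeps
  the limit in the ball.\<close>

lemma weak_star_seq_closureI:
  fixes s :: "nat \<Rightarrow> 'x::real_normed_vector \<Rightarrow>\<^sub>L real"
  assumes "\<And>n. s n \<in> F" "F \<subseteq> cball 0 1"
    and lim: "\<And>f. (\<lambda>n. blinfun_apply (s n) f) \<longlonglongrightarrow> blinfun_apply l f"
  shows "l \<in> seq_closure (weak_star_dual_ball TYPE('x)) F"
proof -
  have s: "s n \<in> cball 0 1" for n using assms(1,2) by blast
  then have "norm l \<le> 1" by (intro norm_le_if_pointwise_limit[OF _ lim]) (auto simp: dist_norm)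
  have "limitin (product_topology (\<lambda>_. euclidean) UNIV) (\<lambda>n. blinfun_apply (s n)) (blinfun_apply l) sequentially"
    unfolding limitin_componentwise using lim by simp
  then have ev: "eventually (\<lambda>n. blinfun_apply (s n) \<in> V) sequentially"
    if "open V" "blinfun_apply l \<in> V" for V
    unfolding euclidean_product_topology using that by (simp add: limitin_def)
  have "limitin (weak_star_dual_ball TYPE('x)) s l sequentially"
    unfolding limitin_def
  proof (intro conjI allI impI)
    show "l \<in> topspace (weak_star_dual_ball TYPE('x))" using \<open>norm l \<le> 1\<close> by simp
    fix U assume U: "openin (weak_star_dual_ball TYPE('x)) U \<and> l \<in> U"
    then obtain V where V: "open V" "U = (blinfun_apply -` V) \<inter> cball 0 1"
      unfolding weak_star_dual_ball_def strong_operator_topology_def openin_subtopology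
        openin_pullback_topology by auto
    have "eventually (\<lambda>n. blinfun_apply (s n) \<in> V) sequentially"
      using U V by (intro ev) auto
    then show "eventually (\<lambda>n. s n \<in> U) sequentially"
      by eventually_elim (use s V(2) in blast)
  qed
  then show ?thesis unfolding seq_closure_def using assms(1) by blast
qed

lemma pointwise_Cauchy_imp_limit:
  fixes s :: "nat \<Rightarrow> 'x::real_normed_vector \<Rightarrow>\<^sub>L real"
  assumes "\<And>n. norm (s n) \<le> M" and "\<And>f. Cauchy (\<lambda>n. blinfun_apply (s n) f)"
  obtains l where "\<And>f. (\<lambda>n. blinfun_apply (s n) f) \<longlonglongrightarrow> blinfun_apply l f"
proof -
  define g where "g f = lim (\<lambda>n. blinfun_apply (s n) f)" for f
  have lim: "(\<lambda>n. blinfun_apply (s n) f) \<longlonglongrightarrow> g f" for f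
    unfolding g_def using assms(2) by (simp add: Cauchy_convergent_iff convergent_LIMSEQ_iff)
  have "bounded_linear g"
  proof (rule bounded_linear_intro)
    show "g (f + h) = g f + g h" for f h
      using tendsto_add[OF lim[of f] lim[of h]] lim[of "f + h"]
      by (simp add: blinfun.add_right LIMSEQ_unique)
    show "g (r *\<^sub>R f) = r *\<^sub>R g f" for r f
      using tendsto_scaleR[OF tendsto_const lim[of f], of r] lim[of "r *\<^sub>R f"]
      by (simp add: blinfun.scaleR_right LIMSEQ_unique)
    show "norm (g f) \<le> norm f * M" for f
    proof -
      have "norm (blinfun_apply (s n) f) \<le> norm f * M" for n
        using norm_blinfun[of "s n" f] mult_right_mono[OF assms(1)[of n], of "norm f"]
        by (simp add: mult.commute)
      then show ?thesis using tendsto_norm[OF lim[of f]] by (intro LIMSEQ_le_const2) auto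
    qed
  qed
  then have "blinfun_apply (Blinfun g) = g" by (rule bounded_linear_Blinfun_apply)
  then show ?thesis using that[of "Blinfun g"] lim by simp
qed

lemma closed_subspace_null_functionals:
  fixes y :: "'i \<Rightarrow> 'x::real_normed_vector \<Rightarrow>\<^sub>L real"
  assumes "\<And>i. norm (y i) \<le> M"
  shows "subspace {f. ((\<lambda>i. blinfun_apply (y i) f) \<longlongrightarrow> 0) F}"
    and "closed {f. ((\<lambda>i. blinfun_apply (y i) f) \<longlongrightarrow> 0) F}"
proof -
  let ?V = "{f. ((\<lambda>i. blinfun_apply (y i) f) \<longlongrightarrow> 0) F}"
  show "subspace ?V"
    unfolding subspace_def
  proof (intro conjI ballI allI)
    show "0 \<in> ?V" by (simp add: blinfun.zero_right)
    show "f + g \<in> ?V" if "f \<in> ?V" "g \<in> ?V" for f g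
      using that tendsto_add[of "\<lambda>i. blinfun_apply (y i) f" 0 F "\<lambda>i. blinfun_apply (y i) g" 0]
      by (simp add: blinfun.add_right)
    show "c *\<^sub>R f \<in> ?V" if "f \<in> ?V" for c f
      using that tendsto_mult_right_zero[of "\<lambda>i. blinfun_apply (y i) f" F c]
      by (simp add: blinfun.scaleR_right)
  qed
  have M: "\<bar>blinfun_apply (y i) f\<bar> \<le> M * norm f" for i f
    using norm_blinfun[of "y i" f] mult_right_mono[OF assms(1)[of i], of "norm f"] by simp
  have "f \<in> ?V" if f: "f \<in> closure ?V" for f
  proof -
    have "eventually (\<lambda>i. \<bar>blinfun_apply (y i) f\<bar> < e) F" if "0 < e" for e
    proof -
      \<comment> \<open>Adding 1 keeps the denominator positive when M = 0.\<close>
      have "0 < e / (2 * (\<bar>M\<bar> + 1))" using that by (intro divide_pos_pos) auto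
      then obtain g where g: "g \<in> ?V" "dist g f < e / (2 * (\<bar>M\<bar> + 1))"
        using f closure_approachable by blast
      have "eventually (\<lambda>i. \<bar>blinfun_apply (y i) g\<bar> < e / 2) F"
        using g(1) that tendstoD[of _ 0 F "e / 2"] by fastforce
      then show ?thesis
      proof eventually_elim
        case (elim i)
        have "(\<bar>M\<bar> + 1) * norm (f - g) \<le> (\<bar>M\<bar> + 1) * (e / (2 * (\<bar>M\<bar> + 1)))"
          using g(2) by (intro mult_left_mono) (auto simp: dist_norm norm_minus_commute)
        also have "\<dots> = e / 2" by (simp add: field_simps)
        finally have "(\<bar>M\<bar> + 1) * norm (f - g) \<le> e / 2" .
        moreover have "M * norm (f - g) \<le> (\<bar>M\<bar> + 1) * norm (f - g)"
          by (intro mult_right_mono) auto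
        ultimately have "\<bar>blinfun_apply (y i) (f - g)\<bar> \<le> e / 2" using M[of i "f - g"] by linarith
        then show ?case using elim unfolding blinfun.diff_right by linarith
      qed
    qed
    then show "f \<in> ?V" by (simp add: tendsto_iff dist_real_def)
  qed
  then show "closed ?V" using closure_subset_eq by blast
qed

lemma Cauchy_iff_prod_sequentially:
  fixes X :: "nat \<Rightarrow> real"
  shows "Cauchy X \<longleftrightarrow> ((\<lambda>(m, n). X m - X n) \<longlongrightarrow> 0) (sequentially \<times>\<^sub>F sequentially)"
  unfolding Cauchy_def tendsto_iff eventually_prod_sequentially
  by (simp add: dist_real_def) (metis abs_minus_commute)

lemma closed_subspace_Cauchy:
  fixes s :: "nat \<Rightarrow> 'x::real_normed_vector \<Rightarrow>\<^sub>L real"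
  assumes "\<And>n. norm (s n) \<le> M"
  shows "subspace {f. Cauchy (\<lambda>n. blinfun_apply (s n) f)}"
    and "closed {f. Cauchy (\<lambda>n. blinfun_apply (s n) f)}"
proof -
  let ?y = "\<lambda>i. s (fst i) - s (snd i)"
  have "norm (?y i) \<le> 2 * M" for i
    using norm_triangle_ineq4[of "s (fst i)" "s (snd i)"] assms[of "fst i"] assms[of "snd i"] by linarith
  note * = closed_subspace_null_functionals[of ?y, OF this, of "sequentially \<times>\<^sub>F sequentially"]
  have eq: "{f. Cauchy (\<lambda>n. blinfun_apply (s n) f)} =
      {f. ((\<lambda>i. blinfun_apply (?y i) f) \<longlongrightarrow> 0) (sequentially \<times>\<^sub>F sequentially)}"
    unfolding Cauchy_iff_prod_sequentially by (simp add: blinfun.diff_left split_def)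
  show "subspace {f. Cauchy (\<lambda>n. blinfun_apply (s n) f)}"
    and "closed {f. Cauchy (\<lambda>n. blinfun_apply (s n) f)}"
    unfolding eq by (rule *)+
qed

lemma closed_subspace_tendsto:
  fixes s :: "nat \<Rightarrow> 'x::real_normed_vector \<Rightarrow>\<^sub>L real"
  assumes "\<And>n. norm (s n) \<le> M"
  shows "subspace {f. (\<lambda>n. blinfun_apply (s n) f) \<longlonglongrightarrow> blinfun_apply x f}"
    and "closed {f. (\<lambda>n. blinfun_apply (s n) f) \<longlonglongrightarrow> blinfun_apply x f}"
proof -
  let ?y = "\<lambda>n. s n - x"
  have "norm (?y n) \<le> M + norm x" for n
    using norm_triangle_ineq4[of "s n" x] assms[of n] by linarith
  note * = closed_subspace_null_functionals[of ?y, OF this, of sequentially]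
  have eq: "{f. (\<lambda>n. blinfun_apply (s n) f) \<longlonglongrightarrow> blinfun_apply x f} =
      {f. (\<lambda>n. blinfun_apply (?y n) f) \<longlonglongrightarrow> 0}"
    by (simp add: blinfun.diff_left LIM_zero_iff)
  show "subspace {f. (\<lambda>n. blinfun_apply (s n) f) \<longlonglongrightarrow> blinfun_apply x f}"
    and "closed {f. (\<lambda>n. blinfun_apply (s n) f) \<longlonglongrightarrow> blinfun_apply x f}"
    unfolding eq by (rule *)+
qed

section \<open>Functions vanishing on a closed set\<close>

definition vanishing_on :: "'k::topological_space set \<Rightarrow> ('k \<Rightarrow>\<^sub>C real) set"
  where "vanishing_on L = {f. \<forall>u\<in>L. apply_bcontfun f u = 0}"

text \<open>Values off L are left free, so a peak matters only modulo \<open>vanishing_on L\<close>.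
  Modulo that subspace, the peaks of the isolated points behave like the unit vectors of
  c_0.\<close>

definition is_peak :: "'k::topological_space set \<Rightarrow> 'k \<Rightarrow> ('k \<Rightarrow>\<^sub>C real) \<Rightarrow> bool"
  where "is_peak L t e \<longleftrightarrow> (\<forall>u\<in>L. apply_bcontfun e u = (if u = t then 1 else 0))"

definition peak :: "'k::topological_space set \<Rightarrow> 'k \<Rightarrow> ('k \<Rightarrow>\<^sub>C real)"
  where "peak L t = (SOME e. is_peak L t e)"

text \<open>Serves two purposes: replacing a function bounded by c on L by one of norm at most c
  with the same values on L, and approximating f by \<open>f - clip c f\<close>, which vanishes
  wherever |f| is at most c.\<close>

definition clip :: "real \<Rightarrow> ('k::topological_space \<Rightarrow>\<^sub>C real) \<Rightarrow> 'k \<Rightarrow>\<^sub>C real"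
  where "clip c f = Bcontfun (\<lambda>u. max (- c) (min c (apply_bcontfun f u)))"

lemma apply_clip:
  assumes "0 \<le> c"
  shows "apply_bcontfun (clip c f) u = max (- c) (min c (apply_bcontfun f u))"
proof -
  have "(\<lambda>u. max (- c) (min c (apply_bcontfun f u))) \<in> bcontfun"
    using assms by (intro bcontfun_normI[of _ c] continuous_intros) auto
  then show ?thesis unfolding clip_def by (simp add: Bcontfun_inverse)
qed

lemma norm_clip: "0 \<le> c \<Longrightarrow> norm (clip c f) \<le> c"
  by (rule norm_bound) (auto simp: apply_clip)

lemma sum_peaks:
  assumes "finite A" "u \<in> L" "\<And>t. t \<in> A \<Longrightarrow> is_peak L t (e t)"
  shows "apply_bcontfun (\<Sum>t\<in>A. c t *\<^sub>R e t) u = (if u \<in> A then c u else 0)"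
proof -
  have "apply_bcontfun (\<Sum>t\<in>A. c t *\<^sub>R e t) u = (\<Sum>t\<in>A. c t * apply_bcontfun (e t) u)"
    using assms(1) by (induction A rule: finite_induct) auto
  also have "\<dots> = (\<Sum>t\<in>A. if u = t then c t else 0)"
    using assms by (intro sum.cong) (auto simp: is_peak_def)
  finally show ?thesis using assms(1) by simp
qed

text \<open>On L the sum takes only the values c t and 0, so clipping at 1 changes it off L only.
  This is the c_0 estimate modulo \<open>vanishing_on L\<close>, independent of the number of
  peaks.\<close>

lemma signed_sum_of_peaks:
  assumes "finite A" "\<And>t. t \<in> A \<Longrightarrow> is_peak L t (e t)" "\<And>t. t \<in> A \<Longrightarrow> \<bar>c t\<bar> \<le> 1"
  obtains g where "norm g \<le> 1" "(\<Sum>t\<in>A. c t *\<^sub>R e t) - g \<in> vanishing_on L"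
proof
  let ?s = "\<Sum>t\<in>A. c t *\<^sub>R e t"
  show "norm (clip 1 ?s) \<le> 1" by (rule norm_clip) simp
  show "?s - clip 1 ?s \<in> vanishing_on L"
    unfolding vanishing_on_def
  proof (intro CollectI ballI)
    fix u assume u: "u \<in> L"
    have "\<bar>apply_bcontfun ?s u\<bar> \<le> 1"
      using sum_peaks[OF assms(1) u, of e c, OF assms(2)] assms(3)[of u] by simp
    then show "apply_bcontfun (?s - clip 1 ?s) u = 0"
      by (simp add: apply_clip)
  qed
qed

text \<open>Urysohn's lemma separates t from the rest of L, which is closed because t is not a limit
  point of L.\<close>

lemma is_peak_peak:
  fixes L :: "'k::t2_space set"
  assumes "compact (UNIV :: 'k set)" "closed L" "\<not> t islimpt L"
  shows "is_peak L t (peak L t)"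
proof -
  obtain T where T: "t \<in> T" "open T" "\<forall>y\<in>L. y \<in> T \<longrightarrow> y = t"
    using assms(3) unfolding islimpt_def by blast
  then have "L - {t} = L - T" by blast
  then have cl: "closed (L - {t})" using assms(2) T(2) by (simp add: closed_Diff)
  have "normal_space (euclidean :: 'k topology)"
  proof (rule compact_Hausdorff_or_regular_imp_normal_space)
    show "compact_space (euclidean :: 'k topology)" using assms(1) by (simp add: compact_space_def)
    show "Hausdorff_space (euclidean :: 'k topology) \<or> regular_space (euclidean :: 'k topology)"
      using hausdorff unfolding Hausdorff_space_def disjnt_def by (metis open_openin)
  qed
  then obtain f where f: "continuous_map (euclidean :: 'k topology) (top_of_set {0..1::real}) f"
      "f ` (L - {t}) \<subseteq> {0}" "f ` {t} \<subseteq> {1}"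
    by (rule Urysohn_lemma[where S="L - {t}" and T="{t}" and a=0 and b=1])
       (use cl in \<open>auto simp: closed_closedin[symmetric] disjnt_def\<close>)
  have "continuous_on UNIV f" and "\<And>u. f u \<in> {0..1}"
    using f(1) by (auto simp: continuous_map_in_subtopology)
  then have "f \<in> bcontfun" by (intro bcontfun_normI[of _ 1]) auto
  then have "is_peak L t (Bcontfun f)"
    unfolding is_peak_def using f(2,3) by (auto simp: Bcontfun_inverse)
  then show ?thesis unfolding peak_def by (rule someI)
qed

section \<open>Closed sets V containing all functions that vanish on a derivative\<close>

lemma vanishing_on_antimono: "L \<subseteq> L' \<Longrightarrow> vanishing_on L' \<subseteq> vanishing_on L"
  unfolding vanishing_on_def by blast

lemma closed_superlevel:
  fixes f :: "'k::topological_space \<Rightarrow>\<^sub>C real"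
  shows "closed {u. \<epsilon> \<le> \<bar>apply_bcontfun f u\<bar>}"
  by (rule closed_Collect_le) (auto intro!: continuous_intros)

text \<open>The functions \<open>f - clip \<epsilon> f\<close> converge uniformly to f as \<epsilon>
  tends to 0, and vanishing wherever |f| is at most \<epsilon> makes them easier to place in
  V.\<close>

lemma in_closed_if_approx_clip:
  fixes V :: "('k::topological_space \<Rightarrow>\<^sub>C real) set"
  assumes "closed V" "\<And>\<epsilon>. 0 < \<epsilon> \<Longrightarrow> f - clip \<epsilon> f \<in> V"
  shows "f \<in> V"
proof -
  have "f \<in> closure V"
    unfolding closure_approachable
  proof (intro allI impI)
    fix e :: real assume "0 < e"
    then have "dist (f - clip (e/2) f) f < e"
      using norm_clip[of "e/2" f] by (simp add: dist_norm)
    moreover have "f - clip (e/2) f \<in> V" using assms(2) \<open>0 < e\<close> by simp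
    ultimately show "\<exists>y\<in>V. dist y f < e" by blast
  qed
  then show ?thesis using assms(1) by simp
qed

lemma diff_clip_eq_0_iff:
  "0 < \<epsilon> \<Longrightarrow> apply_bcontfun (f - clip \<epsilon> f) u = 0 \<longleftrightarrow> \<bar>apply_bcontfun f u\<bar> \<le> \<epsilon>"
  by (auto simp: apply_clip)

text \<open>The points of L where |f| is at least \<epsilon> form a closed set without limit points
  of L, finite by compactness. So \<open>f - clip \<epsilon> f\<close> equals a finite combination
  of peaks on L. This is the successor step of the inductions along the derivatives.\<close>

lemma vanishing_on_derived_set_subset:
  fixes L :: "'k::t2_space set"
  assumes K: "compact (UNIV :: 'k set)" "closed L"
    and V: "subspace V" "closed V" "vanishing_on L \<subseteq> V"
    and peak: "\<And>t. t \<in> L \<Longrightarrow> \<not> t islimpt L \<Longrightarrow> peak L t \<in> V"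
  shows "vanishing_on {x \<in> L. x islimpt L} \<subseteq> V"
proof
  fix f assume f: "f \<in> vanishing_on {x \<in> L. x islimpt L}"
  show "f \<in> V"
  proof (rule in_closed_if_approx_clip[OF V(2)])
    fix \<epsilon> :: real assume "0 < \<epsilon>"
    define h where "h = f - clip \<epsilon> f"
    define A where "A = L \<inter> {u. \<epsilon> \<le> \<bar>apply_bcontfun f u\<bar>}"
    have A: "closed A" unfolding A_def using K(2) closed_superlevel by (rule closed_Int)
    have nlim: "\<not> t islimpt L" if "t \<in> A" for t
      using that f \<open>0 < \<epsilon>\<close> unfolding A_def vanishing_on_def by force
    have "finite A"
    proof (rule ccontr)
      assume "infinite A"
      then obtain t where "t islimpt A"
        using Heine_Borel_imp_Bolzano_Weierstrass[OF K(1), of A] by auto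
      then have "t \<in> A" "t islimpt L"
        using A closed_limpt islimpt_subset unfolding A_def by blast+
      then show False using nlim by blast
    qed
    let ?s = "\<Sum>t\<in>A. apply_bcontfun h t *\<^sub>R peak L t"
    have "apply_bcontfun h u = apply_bcontfun ?s u" if "u \<in> L" for u
    proof -
      have "apply_bcontfun ?s u = (if u \<in> A then apply_bcontfun h u else 0)"
        by (rule sum_peaks[OF \<open>finite A\<close> that]) (rule is_peak_peak[OF K nlim])
      moreover have "apply_bcontfun h u = 0" if "u \<notin> A"
        using that \<open>u \<in> L\<close> \<open>0 < \<epsilon>\<close> unfolding h_def A_def by (subst diff_clip_eq_0_iff) auto
      ultimately show ?thesis by simp
    qed
    then have "h - ?s \<in> V" using V(3) by (auto simp: vanishing_on_def)
    moreover have "?s \<in> V"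
      using peak nlim by (intro subspace_sum[OF V(1)] subspace_scale[OF V(1)]) (auto simp: A_def)
    ultimately have "(h - ?s) + ?s \<in> V" by (rule subspace_add[OF V(1)])
    then show "f - clip \<epsilon> f \<in> V" unfolding h_def by simp
  qed
qed

text \<open>The closed sets \<open>L n \<inter> ?A\<close> decrease and have empty intersection, so
  by compactness one of them is empty, and \<open>f - clip \<epsilon> f\<close> vanishes on that
  \<open>L m\<close>. This is the limit step of the inductions.\<close>

lemma vanishing_on_Inter_subset:
  fixes L :: "nat \<Rightarrow> 'k::t2_space set"
  assumes "compact (UNIV :: 'k set)" "\<And>n. closed (L n)" "antimono L"
    and V: "closed V" "\<And>n. vanishing_on (L n) \<subseteq> V"
  shows "vanishing_on (\<Inter>n. L n) \<subseteq> V"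
proof
  fix f assume f: "f \<in> vanishing_on (\<Inter>n. L n)"
  show "f \<in> V"
  proof (rule in_closed_if_approx_clip[OF V(1)])
    fix \<epsilon> :: real assume "0 < \<epsilon>"
    let ?A = "{u. \<epsilon> \<le> \<bar>apply_bcontfun f u\<bar>}"
    have "UNIV \<subseteq> (\<Union>n. - (L n \<inter> ?A))"
      using f \<open>0 < \<epsilon>\<close> by (fastforce simp: vanishing_on_def)
    moreover have "open (- (L n \<inter> ?A))" for n
      by (intro open_Compl closed_Int assms(2) closed_superlevel)
    ultimately obtain N where N: "finite N" "UNIV \<subseteq> (\<Union>n\<in>N. - (L n \<inter> ?A))"
      using compactE_image[OF assms(1), of UNIV "\<lambda>n. - (L n \<inter> ?A)"] by metis
    \<comment> \<open>Inserting 0 makes \<open>Max\<close> meaningful without showing that N is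
      nonempty.\<close>
    define m where "m = Max (insert 0 N)"
    have "L m \<inter> ?A = {}"
    proof -
      have "u \<notin> ?A" if "u \<in> L m" for u
      proof -
        obtain n where n: "n \<in> N" "u \<notin> L n \<inter> ?A" using N(2) by blast
        have "n \<le> m" unfolding m_def using N(1) n(1) by simp
        then have "u \<in> L n" using that antimonoD[OF assms(3)] by blast
        then show ?thesis using n(2) by blast
      qed
      then show ?thesis by blast
    qed
    then have "f - clip \<epsilon> f \<in> vanishing_on (L m)"
      unfolding vanishing_on_def using diff_clip_eq_0_iff[OF \<open>0 < \<epsilon>\<close>, of f] by force
    then show "f - clip \<epsilon> f \<in> V" using V(2) by blast
  qed
qed

section \<open>Sequential compactness of the dual ball\<close>

text \<open>The diagonal sequence is a subsequence of the n-th extracted one only from some index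
  on; \<open>sub\<close> and \<open>tail\<close> carry P n across.\<close>

lemma diagonal_subsequence:
  fixes P :: "nat \<Rightarrow> (nat \<Rightarrow> nat) \<Rightarrow> bool"
  assumes ex: "\<And>n s. strict_mono (s :: nat \<Rightarrow> nat) \<Longrightarrow> \<exists>r. strict_mono r \<and> P n (s \<circ> r)"
    and sub: "\<And>n s r. strict_mono (r :: nat \<Rightarrow> nat) \<Longrightarrow> P n s \<Longrightarrow> P n (s \<circ> r)"
    and tail: "\<And>n k s. P n (s \<circ> (+) k) \<Longrightarrow> P n s"
  obtains d where "strict_mono d" "\<And>n. P n d"
proof -
  interpret subseqs P using ex by unfold_locales
  show ?thesis
    using that[OF subseq_diagseq] tail[OF diagseq_holds[OF sub]] by blast
qed

lemma abs_blinfun_apply_le: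
  fixes y :: "'x::real_normed_vector \<Rightarrow>\<^sub>L real"
  assumes "norm y \<le> M"
  shows "\<bar>blinfun_apply y f\<bar> \<le> M * norm f"
  using norm_blinfun[of y f] mult_right_mono[OF assms, of "norm f"] by simp

text \<open>The signed sum S collects all gaps in one limit. Modulo \<open>vanishing_on L\<close> it
  can be replaced by a g of norm at most 1, at which functionals of norm at most 1 differ by at most
  2.\<close>

lemma separated_subsequences_card_le:
  fixes s :: "nat \<Rightarrow> ('k::t2_space \<Rightarrow>\<^sub>C real) \<Rightarrow>\<^sub>L real"
  assumes s: "\<And>n. norm (s n) \<le> 1"
    and Cauchy: "\<And>f. f \<in> vanishing_on L \<Longrightarrow> Cauchy (\<lambda>n. blinfun_apply (s n) f)"
    and A: "finite A" "\<And>t. t \<in> A \<Longrightarrow> is_peak L t (e t)"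
    and pq: "strict_mono p" "strict_mono q"
    and v: "\<And>t. t \<in> A \<Longrightarrow> (\<lambda>n. blinfun_apply (s (p n)) (e t)) \<longlonglongrightarrow> v t"
    and w: "\<And>t. t \<in> A \<Longrightarrow> (\<lambda>n. blinfun_apply (s (q n)) (e t)) \<longlonglongrightarrow> w t"
    and sep: "\<And>t. t \<in> A \<Longrightarrow> \<delta> \<le> \<bar>v t - w t\<bar>"
  shows "real (card A) * \<delta> \<le> 2"
proof -
  define S where "S = (\<Sum>t\<in>A. sgn (v t - w t) *\<^sub>R e t)"
  obtain g where g: "norm g \<le> 1" "S - g \<in> vanishing_on L"
    unfolding S_def by (rule signed_sum_of_peaks[OF A, where c="\<lambda>t. sgn (v t - w t)"]) (auto simp: abs_sgn_eq)
  have "(\<lambda>n. blinfun_apply (s (p n)) S) \<longlonglongrightarrow> (\<Sum>t\<in>A. sgn (v t - w t) * v t)"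
    unfolding S_def blinfun.sum_right blinfun.scaleR_right real_scaleR_def
    by (intro tendsto_sum tendsto_mult tendsto_const v)
  moreover have "(\<lambda>n. blinfun_apply (s (q n)) S) \<longlonglongrightarrow> (\<Sum>t\<in>A. sgn (v t - w t) * w t)"
    unfolding S_def blinfun.sum_right blinfun.scaleR_right real_scaleR_def
    by (intro tendsto_sum tendsto_mult tendsto_const w)
  ultimately have "(\<lambda>n. blinfun_apply (s (p n)) S - blinfun_apply (s (q n)) S) \<longlonglongrightarrow>
      (\<Sum>t\<in>A. sgn (v t - w t) * v t) - (\<Sum>t\<in>A. sgn (v t - w t) * w t)"
    by (rule tendsto_diff)
  moreover have "(\<Sum>t\<in>A. sgn (v t - w t) * v t) - (\<Sum>t\<in>A. sgn (v t - w t) * w t) = (\<Sum>t\<in>A. \<bar>v t - w t\<bar>)"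
    unfolding sum_subtractf[symmetric] by (intro sum.cong) (auto simp: abs_sgn algebra_simps)
  ultimately have lim1: "(\<lambda>n. blinfun_apply (s (p n)) S - blinfun_apply (s (q n)) S) \<longlonglongrightarrow> (\<Sum>t\<in>A. \<bar>v t - w t\<bar>)"
    by simp
  \<comment> \<open>On \<open>S - g\<close> both subsequences share the limit c, so passing from S
    to g does not change the limit of the difference.\<close>
  obtain c where c: "(\<lambda>n. blinfun_apply (s n) (S - g)) \<longlonglongrightarrow> c"
    using Cauchy[OF g(2)] by (auto simp: Cauchy_convergent_iff convergent_def)
  have lim2: "(\<lambda>n. blinfun_apply (s (p n)) (S - g) - blinfun_apply (s (q n)) (S - g)) \<longlonglongrightarrow> c - c"
    using LIMSEQ_subseq_LIMSEQ[OF c pq(1)] LIMSEQ_subseq_LIMSEQ[OF c pq(2)]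
    by (intro tendsto_diff) (simp_all add: o_def)
  have "(\<lambda>n. blinfun_apply (s (p n)) g - blinfun_apply (s (q n)) g) \<longlonglongrightarrow> (\<Sum>t\<in>A. \<bar>v t - w t\<bar>)"
    using tendsto_diff[OF lim1 lim2] by (simp add: blinfun.diff_right)
  moreover have "blinfun_apply (s (p n)) g - blinfun_apply (s (q n)) g \<le> 2" for n
    using abs_blinfun_apply_le[OF s[of "p n"], of g] abs_blinfun_apply_le[OF s[of "q n"], of g] g(1) by linarith
  ultimately have "(\<Sum>t\<in>A. \<bar>v t - w t\<bar>) \<le> 2" by (intro LIMSEQ_le_const2) auto
  moreover have "real (card A) * \<delta> \<le> (\<Sum>t\<in>A. \<bar>v t - w t\<bar>)"
    using sum_mono[of A "\<lambda>_. \<delta>" "\<lambda>t. \<bar>v t - w t\<bar>"] sep by simp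
  ultimately show ?thesis by linarith
qed

text \<open>Among the finite sets of peaks on which two subsequences have limits at least \<open>\<delta>\<close> apart,
  one of maximal cardinality exists; its first subsequence oscillates little on every other peak.\<close>

lemma subsequence_with_small_oscillation:
  fixes s :: "nat \<Rightarrow> ('k::t2_space \<Rightarrow>\<^sub>C real) \<Rightarrow>\<^sub>L real"
  assumes s: "\<And>n. norm (s n) \<le> 1"
    and Cauchy: "\<And>f. f \<in> vanishing_on L \<Longrightarrow> Cauchy (\<lambda>n. blinfun_apply (s n) f)"
    and peak: "\<And>t. t \<in> I \<Longrightarrow> is_peak L t (e t)"
    and "0 < \<delta>"
  obtains r :: "nat \<Rightarrow> nat" where "strict_mono r"
    "\<And>t. t \<in> I \<Longrightarrow> \<exists>N. \<forall>m\<ge>N. \<forall>n\<ge>N.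
        \<bar>blinfun_apply (s (r m)) (e t) - blinfun_apply (s (r n)) (e t)\<bar> < 2 * \<delta>"
proof -
  \<comment> \<open>Asking for limits, and not only for a gap, makes separation stable under further
    subsequences.\<close>
  define sep where "sep p q t v w \<longleftrightarrow> (\<lambda>n. blinfun_apply (s (p n)) (e t)) \<longlonglongrightarrow> v \<and>
      (\<lambda>n. blinfun_apply (s (q n)) (e t)) \<longlonglongrightarrow> w \<and> \<delta> \<le> \<bar>v - w\<bar>" for p q t v w
  define good where "good A \<longleftrightarrow> finite A \<and> A \<subseteq> I \<and>
      (\<exists>p q. strict_mono p \<and> strict_mono q \<and> (\<forall>t\<in>A. \<exists>v w. sep p q t v w))" for A
  have card: "card A \<le> nat \<lfloor>2 / \<delta>\<rfloor>" if "good A" for A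
  proof -
    have "\<exists>p q. strict_mono p \<and> strict_mono q \<and> (\<forall>t\<in>A. \<exists>v w. sep p q t v w)"
      using that unfolding good_def by blast
    then obtain p q where pq: "strict_mono p" "strict_mono q" and ex: "\<forall>t\<in>A. \<exists>v w. sep p q t v w"
      by blast
    from ex obtain v w where vw: "\<And>t. t \<in> A \<Longrightarrow> sep p q t (v t) (w t)" by metis
    have "real (card A) * \<delta> \<le> 2"
    proof (rule separated_subsequences_card_le[OF s Cauchy, where A=A and e=e and p=p and q=q and v=v and w=w])
      show "finite A" using that unfolding good_def by blast
      show "is_peak L t (e t)" if "t \<in> A" for t
        using peak \<open>good A\<close> that unfolding good_def by blast
    qed (use vw pq in \<open>simp_all add: sep_def\<close>)
    then have "real (card A) \<le> 2 / \<delta>" using \<open>0 < \<delta>\<close> by (simp add: field_simps)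
    then show ?thesis by (simp add: le_nat_floor)
  qed
  have "strict_mono (id :: nat \<Rightarrow> nat)" by (simp add: strict_mono_def)
  then have "good {}" unfolding good_def by blast
  moreover have "\<forall>A. good A \<longrightarrow> card A < Suc (nat \<lfloor>2 / \<delta>\<rfloor>)"
    using card by (simp add: less_Suc_eq_le)
  ultimately have "\<exists>A. good A \<and> (\<forall>B. good B \<longrightarrow> card B \<le> card A)"
    by (rule ex_has_greatest_nat)
  then obtain A where A: "good A" "\<And>B. good B \<Longrightarrow> card B \<le> card A" by blast
  have "\<exists>p q. strict_mono p \<and> strict_mono q \<and> (\<forall>t\<in>A. \<exists>v w. sep p q t v w)"
    using A(1) unfolding good_def by (elim conjE)
  then obtain p q where pq: "strict_mono p" "strict_mono q" and vw: "\<And>t. t \<in> A \<Longrightarrow> \<exists>v w. sep p q t v w"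
    by blast
  have sep_sub: "sep (p \<circ> h) (q \<circ> k) t v w" if "sep p q t v w" "strict_mono h" "strict_mono k" for h k :: "nat \<Rightarrow> nat" and t v w
    using that LIMSEQ_subseq_LIMSEQ[of "\<lambda>n. blinfun_apply (s (p n)) (e t)" v h]
      LIMSEQ_subseq_LIMSEQ[of "\<lambda>n. blinfun_apply (s (q n)) (e t)" w k]
    unfolding sep_def o_def by blast
  have conv: "\<exists>l h. strict_mono h \<and> (\<lambda>n. blinfun_apply (s (r (h n))) f) \<longlonglongrightarrow> l"
    for r :: "nat \<Rightarrow> nat" and f
  proof -
    have "bounded (range (\<lambda>n. blinfun_apply (s (r n)) f))"
      using abs_blinfun_apply_le[OF s, of _ f] by (auto simp: bounded_iff intro!: exI[of _ "1 * norm f"])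
    then obtain l h where "strict_mono (h :: nat \<Rightarrow> nat)" "((\<lambda>n. blinfun_apply (s (r n)) f) \<circ> h) \<longlonglongrightarrow> l"
      using bounded_imp_convergent_subsequence by metis
    then show ?thesis unfolding o_def by blast
  qed
  have "\<exists>a. eventually (\<lambda>n. \<bar>blinfun_apply (s (p n)) (e t) - a\<bar> < \<delta>) sequentially" if "t \<in> I" for t
  proof (cases "t \<in> A")
    case True
    then obtain v where "(\<lambda>n. blinfun_apply (s (p n)) (e t)) \<longlonglongrightarrow> v" using vw unfolding sep_def by blast
    from tendstoD[OF this \<open>0 < \<delta>\<close>] show ?thesis unfolding dist_real_def by (rule exI)
  next
    case False
    obtain w k where k: "strict_mono k" "(\<lambda>n. blinfun_apply (s (q (k n))) (e t)) \<longlonglongrightarrow> w"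
      using conv by blast
    \<comment> \<open>Otherwise a subsequence of p would have a limit at distance at least \<delta>
      from w, and t could join A, against maximality.\<close>
    have "eventually (\<lambda>n. \<bar>blinfun_apply (s (p n)) (e t) - w\<bar> < \<delta>) sequentially"
    proof (rule ccontr)
      assume "\<not> ?thesis"
      then obtain h :: "nat \<Rightarrow> nat" where h: "strict_mono h" "\<And>n. \<not> \<bar>blinfun_apply (s (p (h n))) (e t) - w\<bar> < \<delta>"
        using not_eventually_sequentiallyD by blast
      obtain v j where j: "strict_mono j" "(\<lambda>n. blinfun_apply (s ((p \<circ> h) (j n))) (e t)) \<longlonglongrightarrow> v"
        using conv by blast
      have hj: "strict_mono (h \<circ> j)" using h(1) j(1) by (rule strict_mono_o)
      have "(\<lambda>n. \<bar>blinfun_apply (s ((p \<circ> h) (j n))) (e t) - w\<bar>) \<longlonglongrightarrow> \<bar>v - w\<bar>"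
        by (intro tendsto_intros j(2))
      then have "\<delta> \<le> \<bar>v - w\<bar>"
        by (rule LIMSEQ_le_const) (use h(2) in \<open>auto simp: not_less\<close>)
      then have "sep (p \<circ> (h \<circ> j)) (q \<circ> k) t v w" using j(2) k(2) unfolding sep_def by (simp add: o_def)
      moreover have "\<exists>v w. sep (p \<circ> (h \<circ> j)) (q \<circ> k) u v w" if "u \<in> A" for u
        using vw[OF that] sep_sub[OF _ hj k(1)] by blast
      ultimately have "\<forall>u\<in>insert t A. \<exists>v w. sep (p \<circ> (h \<circ> j)) (q \<circ> k) u v w" by blast
      moreover have "strict_mono (p \<circ> (h \<circ> j))" "strict_mono (q \<circ> k)"
        using pq hj k(1) by (auto intro: strict_mono_o)
      ultimately have "good (insert t A)"
        using A(1) \<open>t \<in> I\<close> unfolding good_def by blast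
      then have "card (insert t A) \<le> card A" by (rule A(2))
      moreover have "finite A" using A(1) unfolding good_def by blast
      ultimately show False using False by simp
    qed
    then show ?thesis by blast
  qed
  note near = this
  have "\<exists>N. \<forall>m\<ge>N. \<forall>n\<ge>N. \<bar>blinfun_apply (s (p m)) (e t) - blinfun_apply (s (p n)) (e t)\<bar> < 2 * \<delta>"
    if "t \<in> I" for t
  proof -
    from near[OF that] obtain a N where N: "\<And>n. n \<ge> N \<Longrightarrow> \<bar>blinfun_apply (s (p n)) (e t) - a\<bar> < \<delta>"
      unfolding eventually_sequentially by blast
    have "\<bar>blinfun_apply (s (p m)) (e t) - blinfun_apply (s (p n)) (e t)\<bar> < 2 * \<delta>" if "m \<ge> N" "n \<ge> N" for m n
      using N[OF that(1)] N[OF that(2)] by linarith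
    then show ?thesis by blast
  qed
  with pq(1) show ?thesis by (rule that)
qed

text \<open>The diagonal runs over the tolerances 2/(k+1) and not over the peaks, of which there may
  be uncountably many: one subsequence meets a given tolerance at all peaks.\<close>

lemma Cauchy_on_derived_set_subsequence:
  fixes s :: "nat \<Rightarrow> ('k::t2_space \<Rightarrow>\<^sub>C real) \<Rightarrow>\<^sub>L real"
  assumes K: "compact (UNIV :: 'k set)" "closed L"
    and s: "\<And>n. norm (s n) \<le> 1"
    and Cauchy: "\<And>f. f \<in> vanishing_on L \<Longrightarrow> Cauchy (\<lambda>n. blinfun_apply (s n) f)"
  obtains r where "strict_mono r"
    "\<And>f. f \<in> vanishing_on {x \<in> L. x islimpt L} \<Longrightarrow> Cauchy (\<lambda>n. blinfun_apply (s (r n)) f)"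
proof -
  define I where "I = {t \<in> L. \<not> t islimpt L}"
  define P where "P k r \<longleftrightarrow> (\<forall>t\<in>I. \<exists>N. \<forall>m\<ge>N. \<forall>n\<ge>N.
      \<bar>blinfun_apply (s (r m)) (peak L t) - blinfun_apply (s (r n)) (peak L t)\<bar> < 2 * inverse (real (Suc k)))"
    for k and r :: "nat \<Rightarrow> nat"
  have sub: "Cauchy (\<lambda>n. blinfun_apply (s (r n)) f)" if "strict_mono r" "f \<in> vanishing_on L" for r f
    using Cauchy_subseq_Cauchy[OF Cauchy[OF that(2)] that(1)] by (simp add: o_def)
  obtain d where d: "strict_mono d" "\<And>k. P k d"
  proof (rule diagonal_subsequence[of P])
    fix k and h :: "nat \<Rightarrow> nat" assume "strict_mono h"
    show "\<exists>r. strict_mono r \<and> P k (h \<circ> r)"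
    proof (rule subsequence_with_small_oscillation[where s="\<lambda>n. s (h n)" and L=L and I=I and e="peak L" and \<delta>="inverse (real (Suc k))"])
      show "norm (s (h n)) \<le> 1" for n by (rule s)
      show "Cauchy (\<lambda>n. blinfun_apply (s (h n)) f)" if "f \<in> vanishing_on L" for f
        using sub[OF \<open>strict_mono h\<close> that] .
      show "is_peak L t (peak L t)" if "t \<in> I" for t
        using that is_peak_peak[OF K] unfolding I_def by blast
      show "0 < inverse (real (Suc k))" by simp
      fix r :: "nat \<Rightarrow> nat"
      assume "strict_mono r" "\<And>t. t \<in> I \<Longrightarrow> \<exists>N. \<forall>m\<ge>N. \<forall>n\<ge>N.
        \<bar>blinfun_apply (s (h (r m))) (peak L t) - blinfun_apply (s (h (r n))) (peak L t)\<bar> < 2 * inverse (real (Suc k))"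
      then show ?thesis unfolding P_def o_def by blast
    qed
  next
    fix k and h r :: "nat \<Rightarrow> nat" assume r: "strict_mono r" and "P k h"
    have "r n \<ge> N" if "n \<ge> N" for n N using seq_suble[OF r, of n] that by linarith
    then show "P k (h \<circ> r)" using \<open>P k h\<close> unfolding P_def o_def by meson
  next
    fix k j and h :: "nat \<Rightarrow> nat" assume P: "P k (h \<circ> (+) j)"
    show "P k h"
      unfolding P_def
    proof
      fix t assume "t \<in> I"
      then obtain N where N: "\<And>m n. m \<ge> N \<Longrightarrow> n \<ge> N \<Longrightarrow>
        \<bar>blinfun_apply (s (h (j + m))) (peak L t) - blinfun_apply (s (h (j + n))) (peak L t)\<bar> < 2 * inverse (real (Suc k))"
        using P unfolding P_def o_def by blast
      have "\<bar>blinfun_apply (s (h m)) (peak L t) - blinfun_apply (s (h n)) (peak L t)\<bar> < 2 * inverse (real (Suc k))"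
        if "m \<ge> j + N" "n \<ge> j + N" for m n
        using N[of "m - j" "n - j"] that by simp
      then show "\<exists>N. \<forall>m\<ge>N. \<forall>n\<ge>N.
        \<bar>blinfun_apply (s (h m)) (peak L t) - blinfun_apply (s (h n)) (peak L t)\<bar> < 2 * inverse (real (Suc k))"
        by blast
    qed
  qed (rule that)
  let ?V = "{f. Cauchy (\<lambda>n. blinfun_apply (s (d n)) f)}"
  note V = closed_subspace_Cauchy[where s="\<lambda>n. s (d n)", OF s]
  have "vanishing_on {x \<in> L. x islimpt L} \<subseteq> ?V"
  proof (rule vanishing_on_derived_set_subset[OF K V])
    show "vanishing_on L \<subseteq> ?V" using sub[OF d(1)] by blast
    fix t assume "t \<in> L" "\<not> t islimpt L"
    then have "t \<in> I" unfolding I_def by blast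
    have "\<exists>N. \<forall>m\<ge>N. \<forall>n\<ge>N. \<bar>blinfun_apply (s (d m)) (peak L t) - blinfun_apply (s (d n)) (peak L t)\<bar> < \<epsilon>"
      if "0 < \<epsilon>" for \<epsilon>
    proof -
      obtain k where k: "inverse (real (Suc k)) < \<epsilon> / 2" using reals_Archimedean[of "\<epsilon> / 2"] \<open>0 < \<epsilon>\<close> by auto
      obtain N where "\<And>m n. m \<ge> N \<Longrightarrow> n \<ge> N \<Longrightarrow>
          \<bar>blinfun_apply (s (d m)) (peak L t) - blinfun_apply (s (d n)) (peak L t)\<bar> < 2 * inverse (real (Suc k))"
        using d(2)[of k] \<open>t \<in> I\<close> unfolding P_def by blast
      moreover have "2 * inverse (real (Suc k)) < \<epsilon>" using k by simp
      ultimately show ?thesis by (meson order_less_trans)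
    qed
    then show "peak L t \<in> ?V" by (simp add: Cauchy_def dist_real_def)
  qed
  then show ?thesis using that[OF d(1)] by blast
qed

lemma cb_derivative_olimit_sequence:
  assumes "olimit \<eta>" "\<And>n::nat. b n < \<eta>" "\<And>\<beta>. \<beta> < \<eta> \<Longrightarrow> \<exists>n. \<beta> \<le> b n"
  shows "cb_derivative K \<eta> = (\<Inter>n. cb_derivative K (b n))"
proof -
  have "x \<in> cb_derivative K \<beta>" if "\<And>n. x \<in> cb_derivative K (b n)" "\<beta> < \<eta>" for x \<beta>
    using assms(3)[OF that(2)] that(1) cb_derivative_antimono[of \<beta> _ K] by blast
  then show ?thesis unfolding cb_derivative.simps(3)[OF assms(1)] using assms(2) by blast
qed

text \<open>The induction generalises s because at limits the hypothesis is applied to subsequences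
  extracted earlier in the diagonal construction.\<close>

lemma Cauchy_on_cb_derivative_subsequence:
  fixes s :: "nat \<Rightarrow> ('k::t2_space \<Rightarrow>\<^sub>C real) \<Rightarrow>\<^sub>L real"
  assumes K: "compact (UNIV :: 'k set)" and s: "\<And>n. norm (s n) \<le> 1"
  shows "\<exists>r. strict_mono r \<and>
    (\<forall>f\<in>vanishing_on (cb_derivative UNIV \<alpha>). Cauchy (\<lambda>n. blinfun_apply (s (r n)) f))"
  using s
proof (induction \<alpha> arbitrary: s rule: less_induct)
  case (less \<alpha>)
  let ?Y = "\<lambda>\<beta>. vanishing_on (cb_derivative (UNIV :: 'k set) \<beta>)"
  show ?case
  proof (cases \<alpha> rule: cord_exhaust)
    case 1
    \<comment> \<open>The derivative at 0 is the whole space, on which only the zero function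
      vanishes.\<close>
    have "f = 0" if "f \<in> ?Y \<alpha>" for f
      using that unfolding 1 by (intro bcontfun_eqI) (auto simp: vanishing_on_def)
    then have "Cauchy (\<lambda>n. blinfun_apply (s (id n)) f)" if "f \<in> ?Y \<alpha>" for f
      using that by (fastforce simp: blinfun.zero_right Cauchy_def)
    moreover have "strict_mono (id :: nat \<Rightarrow> nat)" by (simp add: strict_mono_def)
    ultimately show ?thesis by blast
  next
    case (2 \<beta>)
    have "\<beta> < \<alpha>" unfolding 2 by (rule less_osuc)
    then obtain r where r: "strict_mono r" "\<And>f. f \<in> ?Y \<beta> \<Longrightarrow> Cauchy (\<lambda>n. blinfun_apply (s (r n)) f)"
      using less.IH[of \<beta> s] less.prems by blast
    obtain q where q: "strict_mono q"
        "\<And>f. f \<in> vanishing_on {x \<in> cb_derivative UNIV \<beta>. x islimpt cb_derivative UNIV \<beta>} \<Longrightarrow>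
          Cauchy (\<lambda>n. blinfun_apply (s (r (q n))) f)"
      using Cauchy_on_derived_set_subsequence[OF K closed_cb_derivative[OF closed_UNIV], where s="\<lambda>n. s (r n)" and ?\<alpha>1=\<beta>]
        r(2) less.prems by blast
    have "\<forall>f\<in>?Y \<alpha>. Cauchy (\<lambda>n. blinfun_apply (s ((r \<circ> q) n)) f)"
      unfolding 2 cb_derivative.simps(2) using q(2) by simp
    then show ?thesis using strict_mono_o[OF r(1) q(1)] by blast
  next
    case 3
    obtain b where b: "\<And>n::nat. b n < \<alpha>" "\<And>\<beta>. \<beta> < \<alpha> \<Longrightarrow> \<exists>n. \<beta> \<le> b n" "mono b"
      using olimit_cofinal_sequence[OF 3] by metis
    define P where "P k r \<longleftrightarrow> (\<forall>f\<in>?Y (b k). Cauchy (\<lambda>n. blinfun_apply (s (r n)) f))" for k r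
    obtain d where d: "strict_mono d" "\<And>k. P k d"
    proof (rule diagonal_subsequence[of P])
      fix k and h :: "nat \<Rightarrow> nat" assume "strict_mono h"
      show "\<exists>r. strict_mono r \<and> P k (h \<circ> r)"
        using less.IH[OF b(1)[of k], of "\<lambda>n. s (h n)"] less.prems unfolding P_def o_def by blast
    next
      fix k and h r :: "nat \<Rightarrow> nat" assume "strict_mono r" "P k h"
      then show "P k (h \<circ> r)"
        unfolding P_def using Cauchy_subseq_Cauchy[of "\<lambda>n. blinfun_apply (s (h n)) _" r] unfolding o_def by blast
    next
      fix k j and h :: "nat \<Rightarrow> nat" assume P: "P k (h \<circ> (+) j)"
      show "P k h"
        unfolding P_def
      proof
        fix f assume "f \<in> ?Y (b k)"
        then have "convergent (\<lambda>n. blinfun_apply (s (h (n + j))) f)"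
          using P unfolding P_def by (simp add: Cauchy_convergent_iff add.commute)
        then show "Cauchy (\<lambda>n. blinfun_apply (s (h n)) f)"
          using convergent_ignore_initial_segment[of "\<lambda>n. blinfun_apply (s (h n)) f" j]
          by (simp add: Cauchy_convergent_iff)
      qed
    qed (rule that)
    have eq: "cb_derivative (UNIV :: 'k set) \<alpha> = (\<Inter>n. cb_derivative UNIV (b n))"
      by (rule cb_derivative_olimit_sequence[OF 3 b(1,2)])
    have "?Y \<alpha> \<subseteq> {f. Cauchy (\<lambda>n. blinfun_apply (s (d n)) f)}"
      unfolding eq
    proof (rule vanishing_on_Inter_subset[OF K])
      show "closed (cb_derivative (UNIV :: 'k set) (b n))" for n
        by (rule closed_cb_derivative[OF closed_UNIV])
      show "antimono (\<lambda>n. cb_derivative (UNIV :: 'k set) (b n))"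
        using b(3) by (intro antimonoI cb_derivative_antimono) (rule monoD)
      show "closed {f. Cauchy (\<lambda>n. blinfun_apply (s (d n)) f)}"
        using closed_subspace_Cauchy(2)[of "\<lambda>n. s (d n)"] less.prems by blast
      show "?Y (b k) \<subseteq> {f. Cauchy (\<lambda>n. blinfun_apply (s (d n)) f)}" for k
        using d(2)[of k] unfolding P_def by blast
    qed
    then show ?thesis using d(1) by blast
  qed
qed

lemma discrete_imp_no_limit_points:
  assumes "discrete L"
  shows "{x \<in> L. x islimpt L} = {}"
proof -
  have "\<not> x islimpt L" if x: "x \<in> L" for x
  proof -
    obtain T where "open T" "T \<inter> L = {x}" using assms x unfolding discrete_def isolated_in_def by blast
    then show ?thesis unfolding islimpt_def by blast
  qed
  then show ?thesis by blast
qed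

text \<open>The derivative after a discrete one is empty, so every function vanishes on it and some
  subsequence is Cauchy at every function.\<close>

lemma dual_ball_sequentially_compact:
  fixes s :: "nat \<Rightarrow> ('k::t2_space \<Rightarrow>\<^sub>C real) \<Rightarrow>\<^sub>L real"
  assumes K: "compact (UNIV :: 'k set)" and ht: "ht_less_omega1 (UNIV :: 'k set)"
    and s: "\<And>n. norm (s n) \<le> 1"
  obtains r l where "strict_mono r" "\<And>f. (\<lambda>n. blinfun_apply (s (r n)) f) \<longlonglongrightarrow> blinfun_apply l f"
proof -
  obtain \<alpha> where "discrete (cb_derivative (UNIV :: 'k set) \<alpha>)"
    using ht unfolding ht_less_omega1_def by blast
  then have "cb_derivative (UNIV :: 'k set) (osuc \<alpha>) = {}"
    unfolding cb_derivative.simps(2) by (rule discrete_imp_no_limit_points)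
  then have all: "f \<in> vanishing_on (cb_derivative (UNIV :: 'k set) (osuc \<alpha>))" for f
    unfolding vanishing_on_def by blast
  obtain r where r: "strict_mono r" "\<And>f. Cauchy (\<lambda>n. blinfun_apply (s (r n)) f)"
    using Cauchy_on_cb_derivative_subsequence[OF K, of s "osuc \<alpha>"] s all by blast
  obtain l where "\<And>f. (\<lambda>n. blinfun_apply (s (r n)) f) \<longlonglongrightarrow> blinfun_apply l f"
    using pointwise_Cauchy_imp_limit[of "\<lambda>n. s (r n)" 1] s r(2) by blast
  then show ?thesis using that r(1) by blast
qed

section \<open>Sequential order of the dual ball\<close>

text \<open>Choosing signs bounds all finite sums of the absolute values by
  \<open>norm \<phi>\<close>, as in the duality of c_0 and l_1; a summable family has countable
  support.\<close>

lemma countable_nonzero_peaks: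
  fixes \<phi> :: "('k::t2_space \<Rightarrow>\<^sub>C real) \<Rightarrow>\<^sub>L real"
  assumes zero: "\<And>f. f \<in> vanishing_on L \<Longrightarrow> blinfun_apply \<phi> f = 0"
    and peak: "\<And>t. t \<in> I \<Longrightarrow> is_peak L t (e t)"
  shows "countable {t \<in> I. blinfun_apply \<phi> (e t) \<noteq> 0}"
proof -
  have "(\<Sum>t\<in>A. \<bar>blinfun_apply \<phi> (e t)\<bar>) \<le> norm \<phi>" if A: "finite A" "A \<subseteq> I" for A
  proof -
    define S where "S = (\<Sum>t\<in>A. sgn (blinfun_apply \<phi> (e t)) *\<^sub>R e t)"
    obtain g where g: "norm g \<le> 1" "S - g \<in> vanishing_on L"
      unfolding S_def
    proof (rule signed_sum_of_peaks[OF A(1), where c="\<lambda>t. sgn (blinfun_apply \<phi> (e t))"])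
      show "is_peak L t (e t)" if "t \<in> A" for t using peak A(2) that by blast
    qed (auto simp: abs_sgn_eq)
    have "(\<Sum>t\<in>A. \<bar>blinfun_apply \<phi> (e t)\<bar>) = blinfun_apply \<phi> S"
      unfolding S_def blinfun.sum_right blinfun.scaleR_right
      by (intro sum.cong) (auto simp: abs_sgn mult.commute)
    also have "\<dots> = blinfun_apply \<phi> g" using zero[OF g(2)] by (simp add: blinfun.diff_right)
    also have "\<dots> \<le> norm \<phi> * norm g" using norm_blinfun[of \<phi> g] by simp
    also have "\<dots> \<le> norm \<phi>" using mult_left_mono[OF g(1), of "norm \<phi>"] by simp
    finally show ?thesis .
  qed
  then have "(\<lambda>t. \<bar>blinfun_apply \<phi> (e t)\<bar>) summable_on I"
    by (intro nonneg_bdd_above_summable_on bdd_aboveI[of _ "norm \<phi>"]) auto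
  then have "countable {t \<in> I. \<bar>blinfun_apply \<phi> (e t)\<bar> \<noteq> 0}" by (rule summable_countable_real)
  then show ?thesis by simp
qed

text \<open>Closing off: \<open>D\<close> is enlarged countably often by the sets \<open>S y\<close> of the functionals \<open>y\<close> that
  approximate \<open>x\<close> on finite subsets of the current \<open>D\<close>.\<close>

lemma adherent_sequence:
  fixes x :: "'x::real_normed_vector \<Rightarrow>\<^sub>L real"
  assumes adh: "weak_star_adherent x G" and C: "countable C"
    and S: "\<And>y. y \<in> G \<Longrightarrow> countable (S y)"
  obtains y :: "nat \<Rightarrow> 'x \<Rightarrow>\<^sub>L real" and D where "\<And>n. y n \<in> G" "C \<subseteq> D" "\<And>n. S (y n) \<subseteq> D"
    "\<And>d. d \<in> D \<Longrightarrow> (\<lambda>n. blinfun_apply (y n) d) \<longlonglongrightarrow> blinfun_apply x d"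
proof -
  have "\<exists>y\<in>G. \<forall>c\<in>E. \<bar>blinfun_apply y c - blinfun_apply x c\<bar> < inverse (real (Suc n))" if "finite E" for E n
    using adh that unfolding weak_star_adherent_def by simp
  then obtain pick where pick: "\<And>E n. finite E \<Longrightarrow> pick E n \<in> G"
      "\<And>E n c. finite E \<Longrightarrow> c \<in> E \<Longrightarrow>
        \<bar>blinfun_apply (pick E n) c - blinfun_apply x c\<bar> < inverse (real (Suc n))"
    by metis
  \<comment> \<open>Each stage adds S of the approximants for all finite subsets of the previous
    stage and all precisions, which is countably many.\<close>
  define D where "D = rec_nat C (\<lambda>_ A. A \<union> (\<Union>E\<in>Fpow A. \<Union>n. S (pick E n)))"
  have D_0: "D 0 = C" and D_Suc: "D (Suc k) = D k \<union> (\<Union>E\<in>Fpow (D k). \<Union>n. S (pick E n))" for k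
    unfolding D_def by simp_all
  have "countable (D k)" for k
  proof (induction k)
    case 0
    show ?case unfolding D_0 by (rule C)
  next
    case (Suc k)
    have "countable (S (pick E n))" if "E \<in> Fpow (D k)" for E n
      using that by (intro S pick(1)) (simp add: Fpow_def)
    then show ?case unfolding D_Suc using Suc by (intro countable_Un countable_UN countable_Fpow) auto
  qed
  then have countable_D: "countable (\<Union>k. D k)" by simp
  have D_mono: "D i \<subseteq> D j" if "i \<le> j" for i j
    by (rule lift_Suc_mono_le[OF _ that]) (auto simp: D_Suc)
  have finite_D: "\<exists>k. E \<subseteq> D k" if "finite E" "E \<subseteq> (\<Union>k. D k)" for E
    using that
  proof (induction E rule: finite_induct)
    case (insert c E)
    then obtain i j where "E \<subseteq> D i" "c \<in> D j" by blast
    then have "insert c E \<subseteq> D (max i j)"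
      using D_mono[of i "max i j"] D_mono[of j "max i j"] by auto
    then show ?case by blast
  qed simp
  \<comment> \<open>The E n exhaust the union by finite sets; the intersection guards against an
    empty union, where \<open>from_nat_into\<close> is arbitrary.\<close>
  define E where "E n = (\<Union>k. D k) \<inter> from_nat_into (\<Union>k. D k) ` {..n}" for n :: nat
  have E: "finite (E n)" for n unfolding E_def by simp
  show ?thesis
  proof (rule that[of "\<lambda>n. pick (E n) n" "\<Union>k. D k"])
    show "pick (E n) n \<in> G" for n using E by (rule pick(1))
    show "C \<subseteq> (\<Union>k. D k)" using D_0 by blast
    show "S (pick (E n) n) \<subseteq> (\<Union>k. D k)" for n
    proof -
      \<comment> \<open>The finite set E n lies in a single stage, so the next stage has absorbed S
        of its approximant.\<close>
      obtain k where "E n \<subseteq> D k" using finite_D[OF E, of n] unfolding E_def by blast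
      then have "E n \<in> Fpow (D k)" using E by (simp add: Fpow_def)
      then have "S (pick (E n) n) \<subseteq> D (Suc k)" unfolding D_Suc by blast
      then show ?thesis by blast
    qed
    fix d assume d: "d \<in> (\<Union>k. D k)"
    then obtain m where m: "d = from_nat_into (\<Union>k. D k) m"
      using from_nat_into_surj[OF countable_D] by metis
    have bound: "norm (blinfun_apply (pick (E n) n) d - blinfun_apply x d) \<le> inverse (real (Suc n))"
      if "m \<le> n" for n
    proof -
      have "d \<in> E n" unfolding E_def using d m that by blast
      then show ?thesis using pick(2)[OF E, of d n n] by simp
    qed
    have "(\<lambda>n. blinfun_apply (pick (E n) n) d - blinfun_apply x d) \<longlonglongrightarrow> 0"
      using LIMSEQ_inverse_real_of_nat
      by (rule Lim_null_comparison[rotated]) (use bound in \<open>auto simp: eventually_sequentially\<close>)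
    then show "(\<lambda>n. blinfun_apply (pick (E n) n) d) \<longlonglongrightarrow> blinfun_apply x d"
      by (rule LIM_zero_cancel)
  qed
qed

section \<open>Agreement with the target on the functions vanishing on a derivative\<close>

definition agree_on :: "'x set \<Rightarrow> ('x::real_normed_vector \<Rightarrow>\<^sub>L real) \<Rightarrow> ('x \<Rightarrow>\<^sub>L real) set"
  where "agree_on D x = {y. \<forall>f\<in>D. blinfun_apply y f = blinfun_apply x f}"

text \<open>Below, \<open>L\<close> is a derivative of the space and \<open>\<alpha>\<close> counts sequential closures. The countable set
  \<open>C\<close> in the exact version yields the adherent one, and at the last, finite derivative it turns
  agreement into equality.\<close>

definition adherent_recovery :: "'k::t2_space set \<Rightarrow> cord \<Rightarrow> bool"
  where "adherent_recovery L \<alpha> \<longleftrightarrow> (\<forall>F x. F \<subseteq> cball 0 1 \<longrightarrow> weak_star_adherent x F \<longrightarrow>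
    weak_star_adherent x
      (seq_closure_iter (weak_star_dual_ball TYPE('k \<Rightarrow>\<^sub>C real)) F \<alpha> \<inter> agree_on (vanishing_on L) x))"

definition exact_recovery :: "'k::t2_space set \<Rightarrow> cord \<Rightarrow> bool"
  where "exact_recovery L \<alpha> \<longleftrightarrow> (\<forall>F x C. F \<subseteq> cball 0 1 \<longrightarrow> weak_star_adherent x F \<longrightarrow> countable C \<longrightarrow>
    seq_closure_iter (weak_star_dual_ball TYPE('k \<Rightarrow>\<^sub>C real)) F \<alpha> \<inter> agree_on (vanishing_on L \<union> C) x \<noteq> {})"

lemma exact_imp_adherent_recovery:
  assumes "exact_recovery L \<alpha>"
  shows "adherent_recovery L \<alpha>"
  unfolding adherent_recovery_def weak_star_adherent_def[of _ "_ \<inter> _"]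
proof (intro allI impI)
  fix F and x :: "('a \<Rightarrow>\<^sub>C real) \<Rightarrow>\<^sub>L real" and C :: "('a \<Rightarrow>\<^sub>C real) set" and e :: real
  assume F: "F \<subseteq> cball 0 1" "weak_star_adherent x F" and C: "finite C" "0 < e"
  obtain y where y: "y \<in> seq_closure_iter (weak_star_dual_ball TYPE('a \<Rightarrow>\<^sub>C real)) F \<alpha>"
      "y \<in> agree_on (vanishing_on L \<union> C) x"
    using assms F countable_finite[OF C(1)] unfolding exact_recovery_def by blast
  then have "y \<in> agree_on (vanishing_on L) x" "\<forall>c\<in>C. blinfun_apply y c = blinfun_apply x c"
    unfolding agree_on_def by blast+
  then show "\<exists>y\<in>seq_closure_iter (weak_star_dual_ball TYPE('a \<Rightarrow>\<^sub>C real)) F \<alpha> \<inter> agree_on (vanishing_on L) x.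
      \<forall>c\<in>C. \<bar>blinfun_apply y c - blinfun_apply x c\<bar> < e"
    using y(1) C(2) by (intro bexI[of _ y]) auto
qed

text \<open>Sequential compactness gives a subsequence converging at every function; its limit has
  the values of x on D.\<close>

lemma convergent_on_imp_seq_closure_agree_on:
  fixes y :: "nat \<Rightarrow> ('k::t2_space \<Rightarrow>\<^sub>C real) \<Rightarrow>\<^sub>L real"
  assumes K: "compact (UNIV :: 'k set)" "ht_less_omega1 (UNIV :: 'k set)"
    and y: "\<And>n. y n \<in> G" "G \<subseteq> cball 0 1"
    and lim: "\<And>f. f \<in> D \<Longrightarrow> (\<lambda>n. blinfun_apply (y n) f) \<longlonglongrightarrow> blinfun_apply x f"
  shows "seq_closure (weak_star_dual_ball TYPE('k \<Rightarrow>\<^sub>C real)) G \<inter> agree_on D x \<noteq> {}"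
proof -
  have "norm (y n) \<le> 1" for n using subsetD[OF y(2) y(1)[of n]] by simp
  then obtain r l where r: "strict_mono r"
      "\<And>f. (\<lambda>n. blinfun_apply (y (r n)) f) \<longlonglongrightarrow> blinfun_apply l f"
    using dual_ball_sequentially_compact[OF K, of y] by blast
  have "l \<in> seq_closure (weak_star_dual_ball TYPE('k \<Rightarrow>\<^sub>C real)) G"
    by (rule weak_star_seq_closureI[of "\<lambda>n. y (r n)"]) (use y r(2) in auto)
  moreover have "blinfun_apply l f = blinfun_apply x f" if "f \<in> D" for f
    using LIMSEQ_unique[OF r(2)[of f]] LIMSEQ_subseq_LIMSEQ[OF lim[OF that] r(1)] by (simp add: o_def)
  ultimately show ?thesis unfolding agree_on_def by blast
qed

lemma seq_closure_iter_subset_cball: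
  assumes "F \<subseteq> cball 0 1"
  shows "seq_closure_iter (weak_star_dual_ball TYPE('x::real_normed_vector)) F \<alpha> \<subseteq> cball 0 1"
  using seq_closure_iter_subset_topspace[of F "weak_star_dual_ball TYPE('x)" \<alpha>] assms by simp

text \<open>Off the countably many peaks on which some term of the sequence differs from \<open>x\<close>,
  all terms agree with \<open>x\<close>, so convergence on a countable set suffices.\<close>

lemma exact_recovery_derived_set:
  fixes L :: "'k::t2_space set"
  assumes K: "compact (UNIV :: 'k set)" "ht_less_omega1 (UNIV :: 'k set)" "closed L"
    and rec: "adherent_recovery L \<alpha>"
  shows "exact_recovery {x \<in> L. x islimpt L} (osuc \<alpha>)"
  unfolding exact_recovery_def seq_closure_iter.simps(2)
proof (intro allI impI)
  fix F and x :: "('k \<Rightarrow>\<^sub>C real) \<Rightarrow>\<^sub>L real" and C :: "('k \<Rightarrow>\<^sub>C real) set"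
  assume F: "F \<subseteq> cball 0 1" "weak_star_adherent x F" and C: "countable C"
  define H where "H = seq_closure_iter (weak_star_dual_ball TYPE('k \<Rightarrow>\<^sub>C real)) F \<alpha>"
  define G where "G = H \<inter> agree_on (vanishing_on L) x"
  define I where "I = {t \<in> L. \<not> t islimpt L}"
  \<comment> \<open>For y in G these peaks are countably many, since \<open>y - x\<close>
    annihilates \<open>vanishing_on L\<close>.\<close>
  define S where "S y = peak L ` {t \<in> I. blinfun_apply (y - x) (peak L t) \<noteq> 0}" for y
  have H: "H \<subseteq> cball 0 1" unfolding H_def using F(1) by (rule seq_closure_iter_subset_cball)
  have adh: "weak_star_adherent x G"
    using rec F unfolding adherent_recovery_def G_def H_def by blast
  have S: "countable (S y)" if "y \<in> G" for y
    unfolding S_def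
  proof (intro countable_image countable_nonzero_peaks[where L=L])
    show "blinfun_apply (y - x) f = 0" if "f \<in> vanishing_on L" for f
      using that \<open>y \<in> G\<close> unfolding G_def agree_on_def by (simp add: blinfun.diff_left)
    show "is_peak L t (peak L t)" if "t \<in> I" for t
      using that is_peak_peak[OF K(1,3)] unfolding I_def by blast
  qed
  obtain y D where y: "\<And>n. y n \<in> G" and D: "C \<subseteq> D" "\<And>n. S (y n) \<subseteq> D"
    and lim: "\<And>d. d \<in> D \<Longrightarrow> (\<lambda>n. blinfun_apply (y n) d) \<longlonglongrightarrow> blinfun_apply x d"
    using adherent_sequence[OF adh C, of S] S by blast
  have yH: "y n \<in> H" for n using y[of n] unfolding G_def by blast
  have yn: "norm (y n) \<le> 1" for n using subsetD[OF H yH[of n]] by simp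
  have "vanishing_on {x \<in> L. x islimpt L} \<subseteq> {f. (\<lambda>n. blinfun_apply (y n) f) \<longlonglongrightarrow> blinfun_apply x f}"
  proof (rule vanishing_on_derived_set_subset[OF K(1,3) closed_subspace_tendsto[OF yn]])
    have "blinfun_apply (y n) f = blinfun_apply x f" if "f \<in> vanishing_on L" for f n
      using y[of n] that unfolding G_def agree_on_def by blast
    then show "vanishing_on L \<subseteq> {f. (\<lambda>n. blinfun_apply (y n) f) \<longlonglongrightarrow> blinfun_apply x f}" by (simp add: subset_iff)
    fix t assume "t \<in> L" "\<not> t islimpt L"
    then have "t \<in> I" unfolding I_def by blast
    show "peak L t \<in> {f. (\<lambda>n. blinfun_apply (y n) f) \<longlonglongrightarrow> blinfun_apply x f}"
    proof (cases "peak L t \<in> D")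
      case True
      then show ?thesis using lim by blast
    next
      case False
      then have "blinfun_apply (y n) (peak L t) = blinfun_apply x (peak L t)" for n
        using D(2)[of n] \<open>t \<in> I\<close> unfolding S_def by (auto simp: blinfun.diff_left)
      then show ?thesis by simp
    qed
  qed
  then have "(\<lambda>n. blinfun_apply (y n) f) \<longlonglongrightarrow> blinfun_apply x f"
    if "f \<in> vanishing_on {x \<in> L. x islimpt L} \<union> C" for f
    using that lim D(1) by blast
  then show "seq_closure (weak_star_dual_ball TYPE('k \<Rightarrow>\<^sub>C real))
      (seq_closure_iter (weak_star_dual_ball TYPE('k \<Rightarrow>\<^sub>C real)) F \<alpha>) \<inter>
      agree_on (vanishing_on {x \<in> L. x islimpt L} \<union> C) x \<noteq> {}"
    unfolding H_def[symmetric] by (rule convergent_on_imp_seq_closure_agree_on[OF K(1,2) yH H])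
qed

text \<open>Along a cofinal b, the n-th term agrees with x on the functions vanishing on the b n-th
  derivative and approximates x on the first elements of C. Each such function is eventually matched
  exactly, and compactness extends convergence to the intersection. The terms lie in the iterate at
  \<eta>; one further closure takes their limit.\<close>

lemma exact_recovery_olimit:
  assumes K: "compact (UNIV :: 'k::t2_space set)" "ht_less_omega1 (UNIV :: 'k set)"
    and \<eta>: "olimit \<eta>"
    and rec: "\<And>\<beta>. \<beta> < \<eta> \<Longrightarrow> adherent_recovery (cb_derivative (UNIV :: 'k set) \<beta>) (g \<beta>)"
    and g: "\<And>\<beta>. \<beta> < \<eta> \<Longrightarrow> g \<beta> < \<eta>"
  shows "exact_recovery (cb_derivative (UNIV :: 'k set) \<eta>) (osuc \<eta>)"
  unfolding exact_recovery_def seq_closure_iter.simps(2)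
proof (intro allI impI)
  fix F and x :: "('k \<Rightarrow>\<^sub>C real) \<Rightarrow>\<^sub>L real" and C :: "('k \<Rightarrow>\<^sub>C real) set"
  assume F: "F \<subseteq> cball 0 1" "weak_star_adherent x F" and C: "countable C"
  let ?K = "cb_derivative (UNIV :: 'k set)"
  define H where "H = seq_closure_iter (weak_star_dual_ball TYPE('k \<Rightarrow>\<^sub>C real)) F"
  have H: "H \<alpha> \<subseteq> cball 0 1" for \<alpha> unfolding H_def using F(1) by (rule seq_closure_iter_subset_cball)
  obtain b where b: "\<And>n::nat. b n < \<eta>" "\<And>\<beta>. \<beta> < \<eta> \<Longrightarrow> \<exists>n. \<beta> \<le> b n" "mono b"
    using olimit_cofinal_sequence[OF \<eta>] by metis
  define E where "E n = C \<inter> from_nat_into C ` {..n}" for n :: nat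
  have "\<exists>y\<in>H (g (b n)) \<inter> agree_on (vanishing_on (?K (b n))) x.
      \<forall>c\<in>E n. \<bar>blinfun_apply y c - blinfun_apply x c\<bar> < inverse (real (Suc n))" for n
  proof -
    have "weak_star_adherent x (H (g (b n)) \<inter> agree_on (vanishing_on (?K (b n))) x)"
      using rec[OF b(1)] F unfolding adherent_recovery_def H_def by blast
    moreover have "finite (E n)" "0 < inverse (real (Suc n))" unfolding E_def by simp_all
    ultimately show ?thesis unfolding weak_star_adherent_def by blast
  qed
  then obtain y where y: "\<And>n. y n \<in> H (g (b n)) \<inter> agree_on (vanishing_on (?K (b n))) x"
    and approx: "\<And>n c. c \<in> E n \<Longrightarrow> \<bar>blinfun_apply (y n) c - blinfun_apply x c\<bar> < inverse (real (Suc n))"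
    by metis
  have yH: "y n \<in> H \<eta>" for n
    using y[of n] g[OF b(1)[of n]] unfolding H_def seq_closure_iter.simps(3)[OF \<eta>] by blast
  have yn: "norm (y n) \<le> 1" for n using subsetD[OF H yH[of n]] by simp
  let ?V = "{f. (\<lambda>n. blinfun_apply (y n) f) \<longlonglongrightarrow> blinfun_apply x f}"
  have eq: "?K \<eta> = (\<Inter>n. ?K (b n))" by (rule cb_derivative_olimit_sequence[OF \<eta> b(1,2)])
  have "vanishing_on (?K \<eta>) \<subseteq> ?V"
    unfolding eq
  proof (rule vanishing_on_Inter_subset[OF K(1)])
    show "closed (?K (b n))" for n by (rule closed_cb_derivative[OF closed_UNIV])
    show "antimono (\<lambda>n. ?K (b n))"
      using b(3) by (intro antimonoI cb_derivative_antimono) (rule monoD)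
    show "closed ?V" by (rule closed_subspace_tendsto(2)[OF yn])
    show "vanishing_on (?K (b m)) \<subseteq> ?V" for m
    proof
      fix f assume f: "f \<in> vanishing_on (?K (b m))"
      have "blinfun_apply (y n) f = blinfun_apply x f" if "m \<le> n" for n
      proof -
        \<comment> \<open>Later derivatives are smaller, so more functions vanish on them.\<close>
        have "?K (b n) \<subseteq> ?K (b m)" using monoD[OF b(3) that] by (rule cb_derivative_antimono)
        then have "f \<in> vanishing_on (?K (b n))" using f subsetD[OF vanishing_on_antimono] by blast
        moreover have "y n \<in> agree_on (vanishing_on (?K (b n))) x" using y[of n] by (rule IntD2)
        ultimately show ?thesis unfolding agree_on_def by simp
      qed
      then have "eventually (\<lambda>n. blinfun_apply (y n) f = blinfun_apply x f) sequentially"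
        unfolding eventually_sequentially by blast
      then show "f \<in> ?V" using tendsto_eventually[of _ "blinfun_apply x f" sequentially] by simp
    qed
  qed
  moreover have "C \<subseteq> ?V"
  proof
    fix c assume c: "c \<in> C"
    obtain m where m: "c = from_nat_into C m" using from_nat_into_surj[OF C c] by metis
    have bound: "norm (blinfun_apply (y n) c - blinfun_apply x c) \<le> inverse (real (Suc n))" if "m \<le> n" for n
    proof -
      have "c \<in> E n" unfolding E_def using c m that by blast
      then show ?thesis using approx[of c n] by simp
    qed
    have "(\<lambda>n. blinfun_apply (y n) c - blinfun_apply x c) \<longlonglongrightarrow> 0"
      using LIMSEQ_inverse_real_of_nat
      by (rule Lim_null_comparison[rotated]) (use bound in \<open>auto simp: eventually_sequentially\<close>)
    then show "c \<in> ?V" by (simp add: LIM_zero_cancel)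
  qed
  ultimately have "(\<lambda>n. blinfun_apply (y n) f) \<longlonglongrightarrow> blinfun_apply x f" if "f \<in> vanishing_on (?K \<eta>) \<union> C" for f
    using that by blast
  then show "seq_closure (weak_star_dual_ball TYPE('k \<Rightarrow>\<^sub>C real))
      (seq_closure_iter (weak_star_dual_ball TYPE('k \<Rightarrow>\<^sub>C real)) F \<eta>) \<inter>
      agree_on (vanishing_on (?K \<eta>) \<union> C) x \<noteq> {}"
    unfolding H_def[symmetric] by (rule convergent_on_imp_seq_closure_agree_on[OF K yH H])
qed

text \<open>The adherent version carries the induction. At 0 no closure has been taken, and F need
  not contain a functional matching x exactly on a countable set, so the exact version starts above
  0.\<close>

lemma recovery_cb_derivative:
  assumes K: "compact (UNIV :: 'k::t2_space set)" "ht_less_omega1 (UNIV :: 'k set)"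
  shows "adherent_recovery (cb_derivative (UNIV :: 'k set) \<alpha>) (order_bound \<alpha>) \<and>
    (\<alpha> \<noteq> 0 \<longrightarrow> exact_recovery (cb_derivative (UNIV :: 'k set) \<alpha>) (order_bound \<alpha>))"
proof (induction \<alpha> rule: less_induct)
  case (less \<alpha>)
  show ?case
  proof (cases \<alpha> rule: cord_exhaust)
    case 1
    have "agree_on (vanishing_on UNIV) x = UNIV" for x :: "('k \<Rightarrow>\<^sub>C real) \<Rightarrow>\<^sub>L real"
    proof -
      have "f = 0" if "f \<in> vanishing_on UNIV" for f :: "'k \<Rightarrow>\<^sub>C real"
        using that by (intro bcontfun_eqI) (simp add: vanishing_on_def)
      then show ?thesis unfolding agree_on_def by (fastforce simp: blinfun.zero_right)
    qed
    then show ?thesis unfolding 1 order_bound_0 adherent_recovery_def by simp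
  next
    case (2 \<beta>)
    have "\<beta> < \<alpha>" unfolding 2 by (rule less_osuc)
    then have "adherent_recovery (cb_derivative (UNIV :: 'k set) \<beta>) (order_bound \<beta>)"
      using less.IH by blast
    then have "exact_recovery (cb_derivative (UNIV :: 'k set) \<alpha>) (order_bound \<alpha>)"
      unfolding 2 cb_derivative.simps(2) order_bound_osuc
      by (rule exact_recovery_derived_set[OF K closed_cb_derivative[OF closed_UNIV]])
    then show ?thesis using exact_imp_adherent_recovery by blast
  next
    case 3
    have "exact_recovery (cb_derivative (UNIV :: 'k set) \<alpha>) (osuc \<alpha>)"
    proof (rule exact_recovery_olimit[OF K 3, of order_bound])
      show "adherent_recovery (cb_derivative (UNIV :: 'k set) \<beta>) (order_bound \<beta>)" if "\<beta> < \<alpha>" for \<beta>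
        using less.IH[OF that] by (rule conjunct1)
      show "order_bound \<beta> < \<alpha>" if "\<beta> < \<alpha>" for \<beta> using 3 that by (rule order_bound_olimit(2))
    qed
    then have "exact_recovery (cb_derivative (UNIV :: 'k set) \<alpha>) (order_bound \<alpha>)"
      unfolding order_bound_olimit(1)[OF 3] .
    then show ?thesis using exact_imp_adherent_recovery by blast
  qed
qed

section \<open>From agreement at the last derivative to equality\<close>

lemma finite_if_discrete_closed:
  fixes L :: "'k::t2_space set"
  assumes "compact (UNIV :: 'k set)" "closed L" "discrete L"
  shows "finite L"
proof (rule ccontr)
  assume "infinite L"
  then obtain t where "t islimpt L"
    using Heine_Borel_imp_Bolzano_Weierstrass[OF assms(1), of L] by auto
  then show False using assms(2) discrete_imp_no_limit_points[OF assms(3)] closed_limpt by blast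
qed

text \<open>As L is finite, its peaks form an admissible countable set C. Agreement on them and on
  \<open>vanishing_on L\<close> extends to the functions vanishing on the derived set of L, which is
  empty, hence to all functions.\<close>

lemma closure_subset_seq_closure_iter:
  fixes L :: "'k::t2_space set" and F :: "(('k \<Rightarrow>\<^sub>C real) \<Rightarrow>\<^sub>L real) set"
  assumes K: "compact (UNIV :: 'k set)" "closed L" "discrete L" and F: "F \<subseteq> cball 0 1"
    and rec: "exact_recovery L \<alpha>"
  shows "weak_star_dual_ball TYPE('k \<Rightarrow>\<^sub>C real) closure_of F \<subseteq>
    seq_closure_iter (weak_star_dual_ball TYPE('k \<Rightarrow>\<^sub>C real)) F \<alpha>"
proof
  fix x assume "x \<in> weak_star_dual_ball TYPE('k \<Rightarrow>\<^sub>C real) closure_of F"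
  then have "weak_star_adherent x F" by (rule weak_star_adherent_if_in_closure)
  moreover have "countable (peak L ` L)"
    using finite_if_discrete_closed[OF K] by (intro countable_finite finite_imageI)
  ultimately obtain y where y: "y \<in> seq_closure_iter (weak_star_dual_ball TYPE('k \<Rightarrow>\<^sub>C real)) F \<alpha>"
    and agree: "y \<in> agree_on (vanishing_on L \<union> peak L ` L) x"
    using rec F unfolding exact_recovery_def by blast
  \<comment> \<open>Equality at f is written as convergence of a constant sequence so that
    \<open>closed_subspace_tendsto\<close> applies.\<close>
  let ?V = "{f. (\<lambda>n::nat. blinfun_apply y f) \<longlonglongrightarrow> blinfun_apply x f}"
  have V: "f \<in> ?V \<longleftrightarrow> blinfun_apply y f = blinfun_apply x f" for f
    by (simp add: LIMSEQ_const_iff)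
  have "vanishing_on {x \<in> L. x islimpt L} \<subseteq> ?V"
  proof (rule vanishing_on_derived_set_subset[OF K(1,2) closed_subspace_tendsto[where M="norm y"]])
    show "vanishing_on L \<subseteq> ?V" using agree unfolding agree_on_def by (auto simp: V)
    show "peak L t \<in> ?V" if "t \<in> L" for t using agree that unfolding agree_on_def V by blast
  qed simp_all
  then have "?V = UNIV" unfolding discrete_imp_no_limit_points[OF K(3)] by (auto simp: vanishing_on_def)
  then have "y = x" using V by (intro blinfun_eqI) blast
  then show "x \<in> seq_closure_iter (weak_star_dual_ball TYPE('k \<Rightarrow>\<^sub>C real)) F \<alpha>" using y by simp
qed

theorem theorem10:
  assumes "compact (UNIV :: 'k::t2_space set)"
    and "infinite (UNIV :: 'k set)"
    and "scattered (UNIV :: 'k set)"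
    and "ht_less_omega1 (UNIV :: 'k set)"
  shows "(ht (UNIV :: 'k set) < oomega \<longrightarrow>
            weak_star_sequential_dual_ball_le TYPE('k \<Rightarrow>\<^sub>C real) (ht (UNIV :: 'k set))) \<and>
         (oomega \<le> ht (UNIV :: 'k set) \<longrightarrow>
            weak_star_sequential_dual_ball_le TYPE('k \<Rightarrow>\<^sub>C real) (osuc (ht (UNIV :: 'k set))))"
proof -
  let ?h = "ht (UNIV :: 'k set)" and ?T = "weak_star_dual_ball TYPE('k \<Rightarrow>\<^sub>C real)"
  let ?L = "cb_derivative (UNIV :: 'k set) ?h"
  have closed: "closed ?L" by (rule closed_cb_derivative[OF closed_UNIV])
  have disc: "discrete ?L"
    using assms(4) unfolding ht_less_omega1_def ht_def by (rule LeastI_ex)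
  \<comment> \<open>Height 0 would make the infinite compact space discrete, hence finite.\<close>
  have "?h \<noteq> 0"
  proof
    assume "?h = 0"
    then have "finite ?L" using finite_if_discrete_closed[OF assms(1) closed disc] by blast
    then show False using assms(2) \<open>?h = 0\<close> by simp
  qed
  then have "exact_recovery ?L (order_bound ?h)"
    using recovery_cb_derivative[OF assms(1,4)] by blast
  then have "?T closure_of F \<subseteq> seq_closure_iter ?T F (order_bound ?h)" if "F \<subseteq> topspace ?T" for F
    using closure_subset_seq_closure_iter[OF assms(1) closed disc] that by simp
  then have "weak_star_sequential_dual_ball_le TYPE('k \<Rightarrow>\<^sub>C real) (order_bound ?h)"
    unfolding weak_star_sequential_dual_ball_le_def
    using sequential_if_seq_closure_iter_eq_closure[of ?T "order_bound ?h"] by blast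
  then show ?thesis unfolding order_bound_def by (cases "?h < oomega") (auto dest: leD)
qed

end
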